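(* Let $\Delta$ be a two-dimensional lattice polygon. Then $\mathrm{ls}_\square(\Delta) = \mathrm{ls}_\square(\Delta^{(1)})+2$, except in the following situations, where the values are as stated. 1. $\Delta \simeq \mathrm{conv}\{(0,0),(a,0),(0,1),(b,1)\}$ with $a\ge 2$ and $a\ge b\ge 0$. Then $\mathrm{ls}_\square(\Delta^{(1)}) = -1$ and $\mathrm{ls}_\square(\Delta) = a$. 2. $\Delta \simeq \mathrm{conv}\{(0,0),(2,0),(0,2)\}$. Then $\mathrm{ls}_\square(\Delta^{(1)}) = -1$ and $\mathrm{ls}_\square(\Delta) = 2$. 3. $\Delta$ is equivalent to one of - $\mathrm{conv}\{(0,0),(3,0),(0,3)\}$, - $\mathrm{conv}\{(0,0),(3,0),(0,2)\}$, - $\mathrm{conv}\{(0,0),(3,0),(2,1),(0,2)\}$, - $\mathrm{conv}\{(0,0),(3,0),(1,2),(0,2)\}$. Then $\mathrm{ls}_\square(\Delta^{(1)}) = 0$ and $\mathrm{ls}_\square(\Delta) = 3$. 4. $\Delta \simeq \mathrm{conv}\{(0,0),(4,0),(0,2)\}$. Then $\mathrm{ls}_\square(\Delta^{(1)}) = 0$ and $\mathrm{ls}_\square(\Delta) = 4$. 5. There exist an edge $\tau$ of $\Delta$ and an edge $\tau'$ of $\Delta^{(1)}$ that are parallel, whose supporting lines are at integral distance $1$ from each other, and such that $\sharp(\tau\cap\mathbb{Z}^2) - \sharp(\tau'\cap\mathbb{Z}^2) \ge 3$. Then $\mathrm{ls}_\square(\Delta^{(1)}) = \sharp(\tau'\cap\mathbb{Z}^2)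 - 1$ and $\mathrm{ls}_\square(\Delta) = \sharp(\tau\cap\mathbb{Z}^2) - 1$; that is, both lattice sizes equal the integral lengths of $\tau'$ and $\tau$ respectively.
   Context: A lattice polygon is the convex hull of finitely many points of $\mathbb{Z}^2$; it may be empty, a point or a segment. $\Delta^{(1)}$ is the convex hull of the lattice points in the interior of $\Delta$. A unimodular transformation is an affine map $v\mapsto Av+w$ with $A\in\mathrm{GL}_2(\mathbb{Z})$ and $w\in\mathbb{Z}^2$; $\Delta\simeq\Delta'$ means $\Delta'=\varphi(\Delta)$ for such a $\varphi$. Let $\square=[0,1]^2$. For a non-empty lattice polygon $\Gamma$, $\mathrm{ls}_\square(\Gamma)$ is the smallest integer $d\ge0$ with $\varphi(\Gamma)\subset d\square$ for some unimodular $\varphi$; by convention $\mathrm{ls}_\square(\emptyset)=-1$. An edge is a one-dimensional face; a one-dimensional polygon is an edge of itself. Two parallel lines $aX+bY=c$ and $aX+bY=c'$, with $a,b$ coprime integers and $c,c'\in\mathbb{Z}$, are at integral distance $|c-c'|$. *)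

theory Defs
  imports "HOL-Analysis.Analysis"
begin

definition lattice_points :: "(real^2) set" where
  "lattice_points = {v. \<forall>i. v $ i \<in> \<int>}"

definition lattice_polygon :: "(real^2) set \<Rightarrow> bool" where
  "lattice_polygon P \<longleftrightarrow> (\<exists>S. finite S \<and> S \<subseteq> lattice_points \<and> P = convex hull S)"

definition interior_polygon :: "(real^2) set \<Rightarrow> (real^2) set" where
  "interior_polygon P = convex hull (interior P \<inter> lattice_points)"

text \<open>Invertibility is over the integers, i.e. the matrix is an element of \<open>GL\<^sub>2(\<int>)\<close>.\<close>

definition unimodular :: "(real^2 \<Rightarrow> real^2) \<Rightarrow> bool" where
  "unimodular \<phi> \<longleftrightarrow>
     (\<exists>(A :: int^2^2) w. invertible A \<and> w \<in> lattice_points \<and>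
        \<phi> = (\<lambda>v. map_matrix real_of_int A *v v + w))"

definition unimod_equiv :: "(real^2) set \<Rightarrow> (real^2) set \<Rightarrow> bool"  (infix \<open>unimod'_equiv\<close> 50) where
  "P unimod_equiv Q \<longleftrightarrow> (\<exists>\<phi>. unimodular \<phi> \<and> Q = \<phi> ` P)"

definition unit_square :: "(real^2) set" where
  "unit_square = {v. \<forall>i. 0 \<le> v $ i \<and> v $ i \<le> 1}"

definition ls_square :: "(real^2) set \<Rightarrow> int" where
  "ls_square P =
     (if P = {} then -1
      else int (LEAST d::nat. \<exists>\<phi>. unimodular \<phi> \<and> \<phi> ` P \<subseteq> (\<lambda>v. real d *\<^sub>R v) ` unit_square))"

definition num_lattice_points :: "(real^2) set \<Rightarrow> int" where
  "num_lattice_points P = int (card (P \<inter> lattice_points))"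

definition int_line :: "int \<Rightarrow> int \<Rightarrow> int \<Rightarrow> (real^2) set" where
  "int_line a b c = {v. of_int a * v $ 1 + of_int b * v $ 2 = of_int c}"

text \<open>In particular the two lines are parallel.\<close>

definition lines_at_integral_distance :: "(real^2) set \<Rightarrow> (real^2) set \<Rightarrow> int \<Rightarrow> bool" where
  "lines_at_integral_distance L L' n \<longleftrightarrow>
     (\<exists>a b c c'. coprime a b \<and> L = int_line a b c \<and> L' = int_line a b c' \<and> n = \<bar>c - c'\<bar>)"

definition situation1 :: "(real^2) set \<Rightarrow> int \<Rightarrow> int \<Rightarrow> bool" where
  "situation1 P a b \<longleftrightarrow> a \<ge> 2 \<and> a \<ge> b \<and> b \<ge> 0 \<and>
     P unimod_equiv
       convex hull {vector [0, 0], vector [of_int a, 0], vector [0, 1], vector [of_int b, 1]}"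

definition situation2 :: "(real^2) set \<Rightarrow> bool" where
  "situation2 P \<longleftrightarrow> P unimod_equiv convex hull {vector [0, 0], vector [2, 0], vector [0, 2]}"

definition situation3 :: "(real^2) set \<Rightarrow> bool" where
  "situation3 P \<longleftrightarrow>
     P unimod_equiv convex hull {vector [0, 0], vector [3, 0], vector [0, 3]} \<or>
     P unimod_equiv convex hull {vector [0, 0], vector [3, 0], vector [0, 2]} \<or>
     P unimod_equiv convex hull {vector [0, 0], vector [3, 0], vector [2, 1], vector [0, 2]} \<or>
     P unimod_equiv convex hull {vector [0, 0], vector [3, 0], vector [1, 2], vector [0, 2]}"

definition situation4 :: "(real^2) set \<Rightarrow> bool" where
  "situation4 P \<longleftrightarrow> P unimod_equiv convex hull {vector [0, 0], vector [4, 0], vector [0, 2]}"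

text \<open>The supporting line of an edge is its affine hull.\<close>

definition situation5 :: "(real^2) set \<Rightarrow> (real^2) set \<Rightarrow> (real^2) set \<Rightarrow> bool" where
  "situation5 P \<tau> \<tau>' \<longleftrightarrow>
     \<tau> edge_of P \<and> \<tau>' edge_of interior_polygon P \<and>
     lines_at_integral_distance (affine hull \<tau>) (affine hull \<tau>') 1 \<and>
     num_lattice_points \<tau> - num_lattice_points \<tau>' \<ge> 3"

end

theory Submission
  imports Defs
begin

text \<open>
  Interior lattice points of a polygon that fits into \<open>[0,e]\<^sup>2\<close> lie in \<open>[1,e-1]\<^sup>2\<close>, so the lattice size
  always drops by at least 2. For the converse let \<open>d\<close> be the lattice size of the interior polygon and
  suppose that \<open>\<Delta>\<close> does not fit into a square of side \<open>d+2\<close>. Among all integral coordinate functions of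
  width at most \<open>d\<close> on the interior polygon and of width at least \<open>d+3\<close> on \<open>\<Delta>\<close>, take one, \<open>y\<close>, of minimal
  width on \<open>\<Delta>\<close>. On one side \<open>\<Delta>\<close> sticks out by at least 2 beyond an extremal interior lattice point \<open>P\<close>.
  Supporting lines through the two lattice points next to the protruding spike, on the row just
  beyond \<open>P\<close>, give coordinates \<open>u, w\<close> with \<open>y = u + w\<close> (up to a constant) and \<open>P = (1,1)\<close> such that interior
  lattice points have \<open>u, w \<ge> 1\<close> and all lattice points of \<open>\<Delta>\<close> lie in the first or third quadrant. Both
  \<open>u\<close> and \<open>w\<close> have width at most \<open>d\<close> on the interior polygon, so one of them, say \<open>u\<close>, has width at
  least \<open>d+3\<close> on \<open>\<Delta>\<close>, and by minimality its width is that of \<open>u + w\<close>. This forces a long edge of \<open>\<Delta>\<close> on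
  \<open>w = 0\<close>. If the row \<open>w = 1\<close> contains at least two interior lattice points, we are in situation 5;
  otherwise two more supporting lines leave only the polygons of situations 3 and 4.
\<close>

subsection \<open>Lattice points and integral affine maps\<close>

text \<open>One device carries every confinement argument: a lattice point that is not interior has
  a nonzero real linear form whose value there bounds the whole set from below. Known interior
  points and known points of the set fix the signs and slopes of that form, and integrality sharpens
  the resulting inequality. Nothing is assumed about the dimension of the interior polygon, so
  points and segments need no separate treatment.

  Minimality of the width is what stops the change of coordinates from going round in circles:
  trading u + w for u cannot gain anything, and the case without gain is rigid.

  Without interior lattice points there is no P to start from. The convention -1 then asks for size
  1, and hollow polygons are classified directly: lattice width one, or the doubled unimodular
  triangle.

  The values claimed in the exceptional situations are a separate matter. A lattice segment of
  length n fits into no square of side below n, and suitable coordinates show that side n is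
  enough.\<close>

definition lin :: "real \<Rightarrow> real \<Rightarrow> int \<times> int \<Rightarrow> real" where
  "lin \<alpha> \<beta> p = \<alpha> * of_int (fst p) + \<beta> * of_int (snd p)"

text \<open>
  By separation these are the interior lattice points of the convex hull of \<open>S\<close>, so the problem becomes
  one about finite sets of integer pairs.
\<close>

definition inner_points :: "(int \<times> int) set \<Rightarrow> (int \<times> int) set" where
  "inner_points S = {p. \<forall>\<alpha> \<beta>. \<alpha> \<noteq> 0 \<or> \<beta> \<noteq> 0 \<longrightarrow> (\<exists>q\<in>S. lin \<alpha> \<beta> q < lin \<alpha> \<beta> p)}"

definition umap :: "(int \<times> int \<Rightarrow> int \<times> int) \<Rightarrow> bool" where
  "umap \<psi> \<longleftrightarrow> (\<exists>a b c d e f. \<bar>a * d - b * c\<bar> = 1 \<and>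
     \<psi> = (\<lambda>p. (a * fst p + b * snd p + e, c * fst p + d * snd p + f)))"

definition fits_square :: "int \<Rightarrow> (int \<times> int) set \<Rightarrow> bool" where
  "fits_square d S \<longleftrightarrow> (\<exists>\<psi>. umap \<psi> \<and>
     (\<forall>p\<in>S. 0 \<le> fst (\<psi> p) \<and> fst (\<psi> p) \<le> d \<and> 0 \<le> snd (\<psi> p) \<and> snd (\<psi> p) \<le> d))"

lemma ex_minimizer:
  fixes f :: "'a \<Rightarrow> 'b::linorder"
  assumes "finite S" "S \<noteq> {}"
  shows "\<exists>x\<in>S. \<forall>y\<in>S. f x \<le> f y"
  using arg_min_if_finite(1)[OF assms, of f] arg_min_least[OF assms] by blast

lemma lin_pair [simp]: "lin \<alpha> \<beta> (x, y) = \<alpha> * of_int x + \<beta> * of_int y"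
  by (simp add: lin_def)

lemma inner_pointsD:
  assumes "p \<in> inner_points S" "\<alpha> \<noteq> 0 \<or> \<beta> \<noteq> 0" "\<And>q. q \<in> S \<Longrightarrow> \<gamma> \<le> lin \<alpha> \<beta> q"
  shows "\<gamma> < lin \<alpha> \<beta> p"
proof -
  obtain q where "q \<in> S" "lin \<alpha> \<beta> q < lin \<alpha> \<beta> p"
    using assms(1,2) unfolding inner_points_def by blast
  then show ?thesis using assms(3)[of q] by linarith
qed

text \<open>Over the integers strictness is worth a full unit: an interior lattice point clears an
  integral supporting line by at least 1. The off-by-one bounds on interior points come from
  here.\<close>

lemma inner_pointsD_int:
  fixes a b c :: int
  assumes "p \<in> inner_points S" "a \<noteq> 0 \<or> b \<noteq> 0" "\<And>q. q \<in> S \<Longrightarrow> c \<le> a * fst q + b * snd q"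
  shows "c < a * fst p + b * snd p"
proof -
  have e: "lin (of_int a) (of_int b) q = of_int (a * fst q + b * snd q)" for q
    by (simp add: lin_def)
  have "of_int c < lin (of_int a) (of_int b) p"
    by (rule inner_pointsD[OF assms(1)]) (use assms(2,3) in \<open>auto simp: e simp del: of_int_add of_int_mult\<close>)
  then show ?thesis by (simp add: e del: of_int_add of_int_mult)
qed

lemma not_inner_pointsE:
  assumes "p \<notin> inner_points S"
  obtains \<alpha> \<beta> where "\<alpha> \<noteq> 0 \<or> \<beta> \<noteq> 0" "\<And>q. q \<in> S \<Longrightarrow> lin \<alpha> \<beta> p \<le> lin \<alpha> \<beta> q"
  using assms unfolding inner_points_def by (auto simp: not_less)

section \<open>Unimodular affine maps of integer pairs\<close>

lemma umapI:
  assumes "\<bar>a * d - b * c\<bar> = 1"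
  shows "umap (\<lambda>p. (a * fst p + b * snd p + e, c * fst p + d * snd p + f))"
  unfolding umap_def using assms by blast

lemma umap_id: "umap (\<lambda>p. p)"
  using umapI[of 1 1 0 0 0 0] by simp

lemma umap_swap: "umap prod.swap"
proof -
  have e: "prod.swap = (\<lambda>p::int \<times> int. (0 * fst p + 1 * snd p + 0, 1 * fst p + 0 * snd p + 0))"
    by (auto simp: fun_eq_iff)
  show ?thesis unfolding e by (rule umapI) simp
qed

lemma umap_comp:
  assumes "umap \<psi>" "umap \<xi>"
  shows "umap (\<psi> \<circ> \<xi>)"
proof -
  obtain a b c d e f where 1: "\<bar>a * d - b * c\<bar> = 1"
    "\<psi> = (\<lambda>p. (a * fst p + b * snd p + e, c * fst p + d * snd p + f))"
    using assms(1) unfolding umap_def by blast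
  obtain a' b' c' d' e' f' where 2: "\<bar>a' * d' - b' * c'\<bar> = 1"
    "\<xi> = (\<lambda>p. (a' * fst p + b' * snd p + e', c' * fst p + d' * snd p + f'))"
    using assms(2) unfolding umap_def by blast
  have "(a*a' + b*c') * (c*b' + d*d') - (a*b' + b*d') * (c*a' + d*c') = (a*d - b*c) * (a'*d' - b'*c')"
    by algebra
  then have "\<bar>(a*a' + b*c') * (c*b' + d*d') - (a*b' + b*d') * (c*a' + d*c')\<bar> = 1"
    using 1(1) 2(1) by (simp add: abs_mult)
  note u = umapI[OF this, of "a*e' + b*f' + e" "c*e' + d*f' + f"]
  have "\<psi> \<circ> \<xi> = (\<lambda>p. ((a*a' + b*c') * fst p + (a*b' + b*d') * snd p + (a*e' + b*f' + e),
                        (c*a' + d*c') * fst p + (c*b' + d*d') * snd p + (c*e' + d*f' + f)))"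
    unfolding 1(2) 2(2) by (rule ext) (simp add: algebra_simps)
  then show ?thesis using u by simp
qed

lemma umap_inverse:
  assumes "umap \<psi>"
  obtains \<xi> where "umap \<xi>" "\<And>p. \<xi> (\<psi> p) = p" "\<And>p. \<psi> (\<xi> p) = p"
proof -
  obtain a b c d e f where 1: "\<bar>a * d - b * c\<bar> = 1"
    and psi: "\<psi> = (\<lambda>p. (a * fst p + b * snd p + e, c * fst p + d * snd p + f))"
    using assms unfolding umap_def by blast
  define D where "D = a * d - b * c"
  have D: "D * D = 1" using 1 unfolding D_def by (metis abs_mult_self_eq mult_1)
  \<comment> \<open>As \<open>D\<close> is its own inverse, \<open>D\<close> times the adjugate
    inverts the matrix over the integers; the last terms undo the translation.\<close>
  define \<xi> where "\<xi> = (\<lambda>p. (D * d * fst p + (- D * b) * snd p + D * (b * f - d * e),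
                             (- D * c) * fst p + D * a * snd p + D * (c * e - a * f)))"
  have "D * d * (D * a) - (- D * b) * (- D * c) = D * D * D"
    by (simp add: D_def algebra_simps)
  then have "\<bar>D * d * (D * a) - (- D * b) * (- D * c)\<bar> = 1"
    using D 1 by (simp add: D_def[symmetric])
  then have "umap \<xi>" unfolding \<xi>_def by (rule umapI)
  moreover have "\<xi> (\<psi> p) = p" for p
  proof -
    obtain x y where [simp]: "p = (x, y)" by (cases p)
    have "D * d * (a*x + b*y + e) + (- D * b) * (c*x + d*y + f) + D * (b * f - d * e) = D * D * x"
         "(- D * c) * (a*x + b*y + e) + D * a * (c*x + d*y + f) + D * (c * e - a * f) = D * D * y"
      by (simp_all add: D_def algebra_simps)
    then show ?thesis by (simp add: D \<xi>_def psi)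
  qed
  moreover have "\<psi> (\<xi> p) = p" for p
  proof -
    obtain x y where [simp]: "p = (x, y)" by (cases p)
    have "a * (D * d * x + (- D * b) * y + D * (b * f - d * e)) + b * ((- D * c) * x + D * a * y + D * (c * e - a * f)) + e = D * D * x + e - D * D * e"
         "c * (D * d * x + (- D * b) * y + D * (b * f - d * e)) + d * ((- D * c) * x + D * a * y + D * (c * e - a * f)) + f = D * D * y + f - D * D * f"
      by (simp_all add: D_def algebra_simps)
    then show ?thesis by (simp add: D \<xi>_def psi)
  qed
  ultimately show ?thesis using that by blast
qed

lemma umap_lin:
  assumes "umap \<psi>" "\<alpha> \<noteq> 0 \<or> \<beta> \<noteq> 0"
  obtains \<alpha>' \<beta>' \<gamma> where "\<alpha>' \<noteq> 0 \<or> \<beta>' \<noteq> 0" "\<And>p. lin \<alpha> \<beta> (\<psi> p) = lin \<alpha>' \<beta>' p + \<gamma>"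
proof -
  obtain a b c d e f where 1: "\<bar>a * d - b * c\<bar> = 1"
    and psi: "\<psi> = (\<lambda>p. (a * fst p + b * snd p + e, c * fst p + d * snd p + f))"
    using assms unfolding umap_def by blast
  define \<alpha>' \<beta>' where "\<alpha>' = \<alpha> * of_int a + \<beta> * of_int c" and "\<beta>' = \<alpha> * of_int b + \<beta> * of_int d"
  have "a * d - b * c \<noteq> 0" using 1 by auto
  then have nz: "real_of_int (a * d - b * c) \<noteq> 0" by linarith
  \<comment> \<open>Cramer's rule recovers the old coefficients up to the nonzero determinant, so
    the new ones cannot both vanish.\<close>
  have "of_int d * \<alpha>' - of_int c * \<beta>' = \<alpha> * of_int (a * d - b * c)"
       "of_int a * \<beta>' - of_int b * \<alpha>' = \<beta> * of_int (a * d - b * c)"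
    by (simp_all add: \<alpha>'_def \<beta>'_def algebra_simps)
  then have "\<alpha>' \<noteq> 0 \<or> \<beta>' \<noteq> 0" using assms(2) nz by auto
  moreover have "lin \<alpha> \<beta> (\<psi> p) = lin \<alpha>' \<beta>' p + (\<alpha> * of_int e + \<beta> * of_int f)" for p
    by (simp add: psi lin_def \<alpha>'_def \<beta>'_def algebra_simps)
  ultimately show ?thesis using that by blast
qed

text \<open>A linear form on the image pulls back to a nonzero form plus a constant, and the
  constant cancels in the comparison. The reverse inclusion is this lemma for the inverse
  map.\<close>

lemma umap_inner_points_mono:
  assumes "umap \<psi>" "p \<in> inner_points S"
  shows "\<psi> p \<in> inner_points (\<psi> ` S)"
  unfolding inner_points_def
proof (clarify)
  fix \<alpha> \<beta> :: real assume "\<alpha> \<noteq> 0 \<or> \<beta> \<noteq> 0"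
  then obtain \<alpha>' \<beta>' \<gamma> where "\<alpha>' \<noteq> 0 \<or> \<beta>' \<noteq> 0" "\<And>p. lin \<alpha> \<beta> (\<psi> p) = lin \<alpha>' \<beta>' p + \<gamma>"
    using umap_lin[OF assms(1)] by blast
  then show "\<exists>q\<in>\<psi> ` S. lin \<alpha> \<beta> q < lin \<alpha> \<beta> (\<psi> p)"
    using assms(2) unfolding inner_points_def by auto
qed

lemma inner_points_image:
  assumes "umap \<psi>"
  shows "inner_points (\<psi> ` S) = \<psi> ` inner_points S"
proof
  obtain \<xi> where c: "umap \<xi>" "\<And>p. \<xi> (\<psi> p) = p" "\<And>p. \<psi> (\<xi> p) = p"
    using umap_inverse[OF assms] by blast
  show "inner_points (\<psi> ` S) \<subseteq> \<psi> ` inner_points S"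
  proof
    fix p assume "p \<in> inner_points (\<psi> ` S)"
    from umap_inner_points_mono[OF c(1) this] have "\<xi> p \<in> inner_points S"
      by (simp add: image_image c)
    then show "p \<in> \<psi> ` inner_points S" by (metis c(3) image_eqI)
  qed
qed (use umap_inner_points_mono[OF assms] in blast)

section \<open>Fitting integer sets into squares\<close>

lemma fits_squareI:
  assumes "umap \<psi>"
    "\<And>p. p \<in> S \<Longrightarrow> 0 \<le> fst (\<psi> p) \<and> fst (\<psi> p) \<le> d \<and> 0 \<le> snd (\<psi> p) \<and> snd (\<psi> p) \<le> d"
  shows "fits_square d S"
  unfolding fits_square_def using assms by blast

lemma fits_squareE:
  assumes "fits_square d S"
  obtains \<psi> where "umap \<psi>"
    "\<And>p. p \<in> S \<Longrightarrow> 0 \<le> fst (\<psi> p) \<and> fst (\<psi> p) \<le> d \<and> 0 \<le> snd (\<psi> p) \<and> snd (\<psi> p) \<le> d"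
  using assms unfolding fits_square_def by blast

lemma fits_square_imageD:
  assumes "umap \<psi>" "fits_square d (\<psi> ` S)"
  shows "fits_square d S"
proof -
  obtain \<xi> where x: "umap \<xi>"
    "\<And>p. p \<in> \<psi> ` S \<Longrightarrow> 0 \<le> fst (\<xi> p) \<and> fst (\<xi> p) \<le> d \<and> 0 \<le> snd (\<xi> p) \<and> snd (\<xi> p) \<le> d"
    using assms(2) fits_squareE by metis
  show ?thesis
    by (rule fits_squareI[OF umap_comp[OF x(1) assms(1)]]) (use x(2) in simp)
qed

lemma fits_square_image:
  assumes "umap \<psi>"
  shows "fits_square d (\<psi> ` S) \<longleftrightarrow> fits_square d S"
proof
  obtain \<xi> where c: "umap \<xi>" "\<And>p. \<xi> (\<psi> p) = p" "\<And>p. \<psi> (\<xi> p) = p"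
    using umap_inverse[OF assms] by blast
  assume "fits_square d S"
  then have "fits_square d (\<xi> ` (\<psi> ` S))" by (simp add: image_image c)
  then show "fits_square d (\<psi> ` S)" by (rule fits_square_imageD[OF c(1)])
qed (rule fits_square_imageD[OF assms])

text \<open>Moving both coordinate minima to 0 is enough. Read backwards, failure to fit into side d
  makes one of the two coordinates wider than d; this is how wide coordinate functions are
  found.\<close>

lemma fits_square_widths:
  assumes "finite S" "0 \<le> d" "\<And>p q. p \<in> S \<Longrightarrow> q \<in> S \<Longrightarrow> fst p - fst q \<le> d \<and> snd p - snd q \<le> d"
  shows "fits_square d S"
proof (cases "S = {}")
  case True
  then show ?thesis using umap_id unfolding fits_square_def by blast
next
  case False
  define x y where "x = Min (fst ` S)" and "y = Min (snd ` S)"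
  have "x \<in> fst ` S" "y \<in> snd ` S" using False assms(1) by (auto simp: x_def y_def)
  then obtain p q where pq: "p \<in> S" "x = fst p" "q \<in> S" "y = snd q" by blast
  have u: "umap (\<lambda>p. (1 * fst p + 0 * snd p + (- x), 0 * fst p + 1 * snd p + (- y)))"
    by (rule umapI) simp
  have m: "x \<le> fst r" "y \<le> snd r" if "r \<in> S" for r
    using that assms(1) by (auto simp: x_def y_def)
  show ?thesis
  proof (rule fits_squareI[OF u])
    fix r assume r: "r \<in> S"
    then show "0 \<le> fst (1 * fst r + 0 * snd r + - x, 0 * fst r + 1 * snd r + - y) \<and>
      fst (1 * fst r + 0 * snd r + - x, 0 * fst r + 1 * snd r + - y) \<le> d \<and>
      0 \<le> snd (1 * fst r + 0 * snd r + - x, 0 * fst r + 1 * snd r + - y) \<and>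
      snd (1 * fst r + 0 * snd r + - x, 0 * fst r + 1 * snd r + - y) \<le> d"
      using m[OF r] assms(3)[OF r pq(1)] assms(3)[OF r pq(3)] pq(2,4) by simp
  qed
qed

text \<open>The image of the segment is n times the first column (a, c) of a unimodular matrix. That
  column is nonzero, so one coordinate spreads over at least n. The lower bounds for the exceptional
  polygons rest on this.\<close>

lemma not_fits_segment:
  assumes "p \<in> S" "q \<in> S" "fst q = fst p + n" "snd q = snd p" "0 \<le> d" "d < n"
  shows "\<not> fits_square d S"
proof
  assume "fits_square d S"
  then obtain \<psi> where u: "umap \<psi>"
    and 2: "\<And>p. p \<in> S \<Longrightarrow> 0 \<le> fst (\<psi> p) \<and> fst (\<psi> p) \<le> d \<and> 0 \<le> snd (\<psi> p) \<and> snd (\<psi> p) \<le> d"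
    unfolding fits_square_def by blast
  obtain a b c d' e f where 1: "\<bar>a * d' - b * c\<bar> = 1"
    and psi: "\<psi> = (\<lambda>p. (a * fst p + b * snd p + e, c * fst p + d' * snd p + f))"
    using u unfolding umap_def by blast
  have "fst (\<psi> q) - fst (\<psi> p) = a * n" "snd (\<psi> q) - snd (\<psi> p) = c * n"
    using assms(3,4) by (simp_all add: psi algebra_simps)
  then have "\<bar>a * n\<bar> \<le> d" "\<bar>c * n\<bar> \<le> d"
    using 2[OF assms(1)] 2[OF assms(2)] by linarith+
  moreover have "x = 0" if "\<bar>x * n\<bar> \<le> d" for x
  proof (rule ccontr)
    assume "x \<noteq> 0"
    then have "1 * n \<le> \<bar>x\<bar> * n" using assms(5,6) by (intro mult_right_mono) auto
    moreover have "\<bar>x * n\<bar> = \<bar>x\<bar> * n" using assms(5,6) by (simp add: abs_mult)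
    ultimately show False using that assms(6) by linarith
  qed
  ultimately have "a = 0" "c = 0" by blast+
  then show False using 1 by simp
qed

lemma fits_square_inner_points:
  assumes "fits_square e S" "inner_points S \<noteq> {}"
  shows "fits_square (e - 2) (inner_points S)" "2 \<le> e"
proof -
  obtain \<psi> where u: "umap \<psi>"
    and s: "\<And>p. p \<in> S \<Longrightarrow> 0 \<le> fst (\<psi> p) \<and> fst (\<psi> p) \<le> e \<and> 0 \<le> snd (\<psi> p) \<and> snd (\<psi> p) \<le> e"
    using assms(1) unfolding fits_square_def by blast
  have b: "1 \<le> fst (\<psi> p) \<and> fst (\<psi> p) \<le> e - 1 \<and> 1 \<le> snd (\<psi> p) \<and> snd (\<psi> p) \<le> e - 1"
    if "p \<in> inner_points S" for p
  proof -
    have i: "\<psi> p \<in> inner_points (\<psi> ` S)" using that inner_points_image[OF u] by blast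
    have "0 < 1 * fst (\<psi> p) + 0 * snd (\<psi> p)" "- e < (-1) * fst (\<psi> p) + 0 * snd (\<psi> p)"
         "0 < 0 * fst (\<psi> p) + 1 * snd (\<psi> p)" "- e < 0 * fst (\<psi> p) + (-1) * snd (\<psi> p)"
      by (rule inner_pointsD_int[OF i]; use s in auto)+
    then show ?thesis by simp
  qed
  obtain p where "p \<in> inner_points S" using assms(2) by blast
  from b[OF this] show "2 \<le> e" by linarith
  have t: "umap (\<lambda>p. (1 * fst p + 0 * snd p + (- 1), 0 * fst p + 1 * snd p + (- 1)))"
    by (rule umapI) simp
  show "fits_square (e - 2) (inner_points S)"
    by (rule fits_squareI[OF umap_comp[OF t u]]) (use b in \<open>force simp: comp_def\<close>)
qed

subsection \<open>Protruding vertices\<close>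

definition quadrants13 :: "(int \<times> int) set" where
  "quadrants13 = {p. 0 \<le> fst p \<and> 0 \<le> snd p \<or> fst p \<le> 0 \<and> snd p \<le> 0}"

text \<open>
  The segment from \<open>(0, 1)\<close> to \<open>(v, -k)\<close> crosses the axis between \<open>(0, 0)\<close> and \<open>(1, 0)\<close>; supporting lines
  through these two points confine \<open>S\<close> to a double wedge.
\<close>

lemma wedge_normalised:
  assumes P: "(0, 1) \<in> inner_points S" and V: "(v, - k) \<in> S" and k: "1 \<le> k" "0 \<le> v" "v \<le> k"
    and low: "\<And>p. p \<in> inner_points S \<Longrightarrow> 1 \<le> snd p"
  shows "\<And>x y. (x, y) \<in> S \<Longrightarrow> x \<le> 1 \<and> 0 \<le> x + y \<or> 1 \<le> x \<and> x + y \<le> 0"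
    and "\<And>x y. (x, y) \<in> inner_points S \<Longrightarrow> x \<le> 0 \<and> 1 \<le> x + y"
proof -
  \<comment> \<open>Both points lie on the row just below all interior lattice points. The form
    (\<alpha>, \<beta>) belongs to (0, 0), and (\<alpha>', \<beta>') to (1, 0).\<close>
  have "(0, 0) \<notin> inner_points S" "(1, 0) \<notin> inner_points S" using low by force+
  then obtain \<alpha> \<beta> \<alpha>' \<beta>' where
    nz: "\<alpha> \<noteq> 0 \<or> \<beta> \<noteq> 0" "\<alpha>' \<noteq> 0 \<or> \<beta>' \<noteq> 0"
    and ge: "\<And>q. q \<in> S \<Longrightarrow> 0 \<le> lin \<alpha> \<beta> q" "\<And>q. q \<in> S \<Longrightarrow> \<alpha>' \<le> lin \<alpha>' \<beta>' q"
    by (elim not_inner_pointsE) simp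
  have b: "0 < \<beta>" "\<alpha>' < \<beta>'"
    using inner_pointsD[OF P nz(1) ge(1)] inner_pointsD[OF P nz(2) ge(2)] by simp_all
  \<comment> \<open>The tip of the spike controls the slopes: together with 0 <= v <= k these
    inequalities lead to 0 < \<beta> <= \<alpha> and to \<alpha>' < 0, \<beta>' <= 0.\<close>
  have c: "\<beta> * k \<le> \<alpha> * v" "\<alpha>' + \<beta>' * k \<le> \<alpha>' * v"
    using ge(1)[OF V] ge(2)[OF V] by simp_all
  have k': "1 \<le> real_of_int k" "0 \<le> real_of_int v" "real_of_int v \<le> real_of_int k" using k by simp_all
  have "0 < \<beta> * k" using b(1) k' by simp
  then have a: "0 < \<alpha>" using c(1) k' by (metis less_le_trans mult_le_0_iff not_less)
  have "\<beta> * k \<le> \<alpha> * k" using c(1) a k' mult_left_mono[of v k \<alpha>] by linarith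
  then have s: "\<beta> \<le> \<alpha>" using k' by simp
  have v0: "1 \<le> real_of_int v"
  proof -
    have "v \<noteq> 0" using c(1) \<open>0 < \<beta> * k\<close> by auto
    then show ?thesis using k by simp
  qed
  have a': "\<alpha>' < 0"
  proof (rule ccontr)
    assume "\<not> \<alpha>' < 0"
    then have "\<alpha>' * v \<le> \<alpha>' * k" "\<alpha>' * k \<le> \<beta>' * k"
      using k' b(2) by (auto intro: mult_left_mono mult_right_mono)
    then have z: "\<alpha>' = 0" using c(2) \<open>\<not> \<alpha>' < 0\<close> by linarith
    then have "\<beta>' * k \<le> 0" using c(2) by simp
    then show False using z b(2) k' by (simp add: mult_le_0_iff)
  qed
  have t: "\<beta>' \<le> 0"
  proof -
    have "\<beta>' * k \<le> \<alpha>' * (v - 1)" using c(2) by (simp add: algebra_simps)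
    also have "\<dots> \<le> 0" using a' v0 by (simp add: mult_le_0_iff)
    finally show ?thesis using k' by (simp add: mult_le_0_iff)
  qed
  \<comment> \<open>On rows y >= 0 these signs let the two supporting lines be relaxed to the
    integral lines x + y = 0 and x = 1.\<close>
  have up: "\<alpha> * (x + y) \<ge> \<alpha> * x + \<beta> * y" "\<alpha>' * (x - 1) \<ge> \<alpha>' * (x - 1) + \<beta>' * y"
    if "0 \<le> y" for x y :: real
    using that s t mult_right_mono[of \<beta> \<alpha> y] by (auto simp: algebra_simps mult_nonpos_nonneg)
  show "x \<le> 1 \<and> 0 \<le> x + y \<or> 1 \<le> x \<and> x + y \<le> 0" if p: "(x, y) \<in> S" for x y
  proof (cases "0 \<le> y")
    case True
    have "0 \<le> \<alpha> * (x + y)" "0 \<le> \<alpha>' * (real_of_int x - 1)"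
      using up[of y x] ge[OF p] True by (auto simp: algebra_simps)
    then have "0 \<le> real_of_int x + y" "real_of_int x \<le> 1"
      using a a' by (auto simp: zero_le_mult_iff)
    then show ?thesis by linarith
  next
    case False
    then have y: "real_of_int y \<le> -1" by linarith
    \<comment> \<open>Below the axis the terms in y change sign, so the first form now forces x > 0
      and the second x + y < 1: the opposite wedge.\<close>
    have "\<beta> * y < 0" using b y by (simp add: mult_pos_neg)
    then have "0 < \<alpha> * x" using ge(1)[OF p] by simp
    then have x: "0 < x" using a by (simp add: zero_less_mult_iff)
    have "0 < (\<alpha>' - \<beta>') * y" using b(2) y by (simp add: mult_neg_neg)
    then have "0 < \<alpha>' * (real_of_int x + y - 1)" using ge(2)[OF p] by (simp add: algebra_simps)
    then have "real_of_int x + y < 1" using a' by (simp add: zero_less_mult_iff)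
    then show ?thesis using x by linarith
  qed
  show "x \<le> 0 \<and> 1 \<le> x + y" if p: "(x, y) \<in> inner_points S" for x y
  proof -
    have y: "0 \<le> real_of_int y" using low[OF p] by simp
    have "0 < \<alpha> * (x + y)" "0 < \<alpha>' * (real_of_int x - 1)"
      using up[OF y, of x] inner_pointsD[OF p nz(1) ge(1)] inner_pointsD[OF p nz(2) ge(2)]
      by (auto simp: algebra_simps)
    then have "0 < real_of_int x + y" "real_of_int x < 1"
      using a a' by (auto simp: zero_less_mult_iff)
    then show ?thesis by linarith
  qed
qed

text \<open>A shear and a translation normalise the spike; the coordinates u = 1 - x and w = x + y
  then straighten the double wedge into two opposite quadrants.\<close>

lemma wedge:
  assumes P: "P \<in> inner_points S" and V: "V \<in> S" "snd V \<le> snd P - 2"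
    and low: "\<And>p. p \<in> inner_points S \<Longrightarrow> snd P \<le> snd p"
  obtains \<psi> where "umap \<psi>" "\<And>p. fst (\<psi> p) + snd (\<psi> p) = snd p - snd P + 2" "\<psi> P = (1, 1)"
    "\<psi> ` S \<subseteq> quadrants13" "\<And>p. p \<in> inner_points (\<psi> ` S) \<Longrightarrow> 1 \<le> fst p \<and> 1 \<le> snd p"
proof -
  define k where "k = snd P - 1 - snd V"
  have k: "1 \<le> k" using V by (simp add: k_def)
  \<comment> \<open>Division by the height difference k + 1 = snd P - snd V leaves a remainder v
    between 0 and k, so after the shear the segment from P to V crosses the row below P between (0,
    0) and (1, 0).\<close>
  define c where "c = (fst V - fst P) div (k + 1)"
  define v where "v = (fst V - fst P) mod (k + 1)"
  define \<xi> where "\<xi> = (\<lambda>p. (1 * fst p + c * snd p + (- fst P - c * snd P), 0 * fst p + 1 * snd p + (1 - snd P)))"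
  have xi: "umap \<xi>" unfolding \<xi>_def by (rule umapI) simp
  have I: "inner_points (\<xi> ` S) = \<xi> ` inner_points S" by (rule inner_points_image[OF xi])
  have "fst V - fst P = c * (k + 1) + v" unfolding c_def v_def by (rule div_mult_mod_eq[symmetric])
  then have xV: "\<xi> V = (v, - k)" by (simp add: \<xi>_def k_def algebra_simps)
  have xP: "\<xi> P = (0, 1)" by (simp add: \<xi>_def)
  have v: "0 \<le> v" "v \<le> k" using k pos_mod_bound[of "k + 1" "fst V - fst P"] by (auto simp: v_def)
  have 1: "(0, 1) \<in> inner_points (\<xi> ` S)" "(v, - k) \<in> \<xi> ` S"
    using P V(1) xP xV I by (metis image_eqI)+
  have 2: "1 \<le> snd p" if "p \<in> inner_points (\<xi> ` S)" for p
    using that low unfolding I by (force simp: \<xi>_def)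
  note w = wedge_normalised[OF 1 k v 2]
  define \<zeta> where "\<zeta> = (\<lambda>p::int \<times> int. ((-1) * fst p + 0 * snd p + 1, 1 * fst p + 1 * snd p + 0))"
  have ze: "umap \<zeta>" unfolding \<zeta>_def by (rule umapI) simp
  show thesis
  proof (rule that[of "\<zeta> \<circ> \<xi>"])
    show "umap (\<zeta> \<circ> \<xi>)" by (rule umap_comp[OF ze xi])
    show "fst ((\<zeta> \<circ> \<xi>) p) + snd ((\<zeta> \<circ> \<xi>) p) = snd p - snd P + 2" for p
      by (simp add: \<zeta>_def \<xi>_def)
    show "(\<zeta> \<circ> \<xi>) P = (1, 1)" by (simp add: xP \<zeta>_def)
    have "\<zeta> q \<in> quadrants13" if "q \<in> \<xi> ` S" for q
      using w(1)[of "fst q" "snd q"] that by (auto simp: \<zeta>_def quadrants13_def)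
    then show "(\<zeta> \<circ> \<xi>) ` S \<subseteq> quadrants13" by (simp add: image_subset_iff)
    show "1 \<le> fst p \<and> 1 \<le> snd p" if "p \<in> inner_points ((\<zeta> \<circ> \<xi>) ` S)" for p
    proof -
      have "p \<in> \<zeta> ` inner_points (\<xi> ` S)"
        using that by (simp only: image_comp[symmetric] inner_points_image[OF ze])
      then obtain q where "q \<in> inner_points (\<xi> ` S)" "p = \<zeta> q" by blast
      then show ?thesis using w(2)[of "fst q" "snd q"] by (simp add: \<zeta>_def)
    qed
  qed
qed

subsection \<open>The exceptional polygons in normal form\<close>

text \<open>The points (m, 0) and (M, 0) need not be the ends of the bottom edge, which thus carries
  at least M - m + 1 lattice points; the bound M - m - 2 encodes the difference of 3. Two interior
  points on row 1 make that row an honest edge of the interior polygon.\<close>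

definition shape5 :: "(int \<times> int) set \<Rightarrow> bool" where
  "shape5 S \<longleftrightarrow> (\<forall>p\<in>S. 0 \<le> snd p) \<and>
     (\<exists>m M. (m, 0) \<in> S \<and> (M, 0) \<in> S \<and>
        2 \<le> card {p \<in> inner_points S. snd p = 1} \<and> int (card {p \<in> inner_points S. snd p = 1}) \<le> M - m - 2)"

text \<open>Here and for \<open>shape3\<close>, the listed points force the hull to contain the
  model polygon, and the inequalities, its edges, force it to be no larger. This pins down the hull
  without mentioning real points.\<close>

definition shape4 :: "(int \<times> int) set \<Rightarrow> bool" where
  "shape4 S \<longleftrightarrow> {(0, 0), (4, 0), (0, 2)} \<subseteq> S \<and> (\<forall>p\<in>S. 0 \<le> fst p \<and> 0 \<le> snd p \<and> fst p + 2 * snd p \<le> 4)"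

definition shape3 :: "(int \<times> int) set \<Rightarrow> bool" where
  "shape3 S \<longleftrightarrow> (\<forall>p\<in>S. 0 \<le> fst p \<and> 0 \<le> snd p) \<and>
     ({(0, 0), (3, 0), (0, 3)} \<subseteq> S \<and> (\<forall>p\<in>S. fst p + snd p \<le> 3) \<or>
      {(0, 0), (3, 0), (0, 2)} \<subseteq> S \<and> (\<forall>p\<in>S. 2 * fst p + 3 * snd p \<le> 6) \<or>
      {(0, 0), (3, 0), (2, 1), (0, 2)} \<subseteq> S \<and> (\<forall>p\<in>S. fst p + snd p \<le> 3 \<and> fst p + 2 * snd p \<le> 4) \<or>
      {(0, 0), (3, 0), (1, 2), (0, 2)} \<subseteq> S \<and> (\<forall>p\<in>S. fst p + snd p \<le> 3 \<and> snd p \<le> 2))"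

definition exceptional :: "(int \<times> int) set \<Rightarrow> bool" where
  "exceptional S \<longleftrightarrow> (\<exists>\<psi>. umap \<psi> \<and> (shape3 (\<psi> ` S) \<or> shape4 (\<psi> ` S) \<or> shape5 (\<psi> ` S)))"

lemma exceptional_image:
  assumes "umap \<xi>" "exceptional (\<xi> ` S)"
  shows "exceptional S"
proof -
  obtain \<psi> where "umap \<psi>" "shape3 (\<psi> ` \<xi> ` S) \<or> shape4 (\<psi> ` \<xi> ` S) \<or> shape5 (\<psi> ` \<xi> ` S)"
    using assms(2) unfolding exceptional_def by blast
  then show ?thesis unfolding exceptional_def
    using umap_comp[OF _ assms(1)] by (metis image_comp)
qed

lemma exceptionalI: "shape3 S \<or> shape4 S \<or> shape5 S \<Longrightarrow> exceptional S"
  unfolding exceptional_def using umap_id by (intro exI[of _ "\<lambda>p. p"]) simp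

text \<open>The triangle with legs 3 has only ten lattice points. Asking in turn whether (0, 3), (1,
  2) or (2, 1) belongs to the set selects one of the four models, provided that the left leg carries
  a point of height at least 2.\<close>

lemma triangle_size3_subsets:
  assumes o: "(0, 0) \<in> S" "(3, 0) \<in> S" and Z: "Z \<in> S" "2 \<le> snd Z"
    and b: "\<And>x y. (x, y) \<in> S \<Longrightarrow> 0 \<le> x \<and> 0 \<le> y \<and> x + y \<le> 3"
  shows "exceptional S"
proof -
  have main: "shape3 T" if T: "(0, 0) \<in> T" "(3, 0) \<in> T" "(0, 2) \<in> T \<or> (0, 3) \<in> T"
    and bT: "\<And>x y. (x, y) \<in> T \<Longrightarrow> 0 \<le> x \<and> 0 \<le> y \<and> x + y \<le> 3" for T
  proof -
    have c: "p \<in> {(0,0),(1,0),(2,0),(3,0),(0,1),(1,1),(2,1),(0,2),(1,2),(0,3)}" if "p \<in> T" for p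
    proof -
      obtain x y where p: "p = (x, y)" by (cases p)
      have xy: "0 \<le> x" "0 \<le> y" "x + y \<le> 3" using bT that p by auto
      then have "y = 0 \<or> y = 1 \<or> y = 2 \<or> y = 3" by linarith
      then show ?thesis
      proof (elim disjE)
        assume y: "y = 0"
        then have "x = 0 \<or> x = 1 \<or> x = 2 \<or> x = 3" using xy by linarith
        then show ?thesis using y p by simp
      next
        assume y: "y = 1"
        then have "x = 0 \<or> x = 1 \<or> x = 2" using xy by linarith
        then show ?thesis using y p by simp
      next
        assume y: "y = 2"
        then have "x = 0 \<or> x = 1" using xy by linarith
        then show ?thesis using y p by simp
      next
        assume y: "y = 3"
        then have "x = 0" using xy by linarith
        then show ?thesis using y p by simp
      qed
    qed
    consider "(0, 3) \<in> T" | "(0, 3) \<notin> T" "(1, 2) \<in> T" | "(0, 3) \<notin> T" "(1, 2) \<notin> T" "(2, 1) \<in> T"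
      | "(0, 3) \<notin> T" "(1, 2) \<notin> T" "(2, 1) \<notin> T" by blast
    then show ?thesis
    proof cases
      case 1
      then show ?thesis using T bT unfolding shape3_def by auto
    next
      case 2
      have "snd p \<le> 2" if "p \<in> T" for p
      proof -
        have "p \<noteq> (0, 3)" using 2 that by auto
        then show ?thesis using c[OF that] by auto
      qed
      then show ?thesis using 2 T bT unfolding shape3_def by (intro conjI) auto
    next
      case 3
      have "fst p + 2 * snd p \<le> 4" if "p \<in> T" for p
      proof -
        have "p \<noteq> (0, 3)" "p \<noteq> (1, 2)" using 3 that by auto
        then show ?thesis using c[OF that] by auto
      qed
      then show ?thesis using 3 T bT unfolding shape3_def by (intro conjI) auto
    next
      case 4
      have "2 * fst p + 3 * snd p \<le> 6" if "p \<in> T" for p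
      proof -
        have "p \<noteq> (0, 3)" "p \<noteq> (1, 2)" "p \<noteq> (2, 1)" using 4 that by auto
        then show ?thesis using c[OF that] by auto
      qed
      then show ?thesis using 4 T bT unfolding shape3_def by (intro conjI) auto
    qed
  qed
  show ?thesis
  proof (cases "(0, 2) \<in> S \<or> (0, 3) \<in> S")
    case True
    then show ?thesis using main[OF o _ b] exceptionalI by blast
  next
    case False
    obtain x y where "Z = (x, y)" by (cases Z)
    then have "(x, y) \<in> S" "0 \<le> x" "x + y \<le> 3" "2 \<le> y" using Z b by auto
    moreover from this have "x = 0 \<and> y = 2 \<or> x = 0 \<and> y = 3 \<or> x = 1 \<and> y = 2" by auto
    ultimately have Z: "(1, 2) \<in> S" using False by auto
    \<comment> \<open>The symmetry of the triangle that exchanges (0, 0) and (3, 0) carries (1, 2)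
      to (0, 2).\<close>
    define \<rho> where "\<rho> = (\<lambda>p::int \<times> int. ((-1) * fst p + (-1) * snd p + 3, 0 * fst p + 1 * snd p + 0))"
    have r: "umap \<rho>" unfolding \<rho>_def by (rule umapI) simp
    have "shape3 (\<rho> ` S)"
    proof (rule main)
      show "(0, 0) \<in> \<rho> ` S" "(3, 0) \<in> \<rho> ` S" "(0, 2) \<in> \<rho> ` S \<or> (0, 3) \<in> \<rho> ` S"
        using o Z by (force simp: \<rho>_def)+
      show "0 \<le> x \<and> 0 \<le> y \<and> x + y \<le> 3" if "(x, y) \<in> \<rho> ` S" for x y
        using that b by (force simp: \<rho>_def)
    qed
    then show ?thesis using exceptionalI exceptional_image[OF r] by blast
  qed
qed

subsection \<open>Polygons with interior lattice points\<close>

text \<open>Strictness in x + y <= M leaves at most M - 2 interior points on row 1, which gives the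
  difference of 3 between the rows. If (1, 1) is alone on its row, that row yields no edge, but its
  two neighbours are then not interior and supply confining lines.\<close>

lemma exceptional_of_long_row:
  assumes P: "(1, 1) \<in> inner_points S" and I: "\<And>p. p \<in> inner_points S \<Longrightarrow> 1 \<le> fst p \<and> 1 \<le> snd p"
    and ends: "(m, 0) \<in> S" "(M, 0) \<in> S" and m: "m \<le> 0" "m + 3 \<le> M"
    and b: "\<And>p. p \<in> S \<Longrightarrow> 0 \<le> snd p \<and> m \<le> fst p + snd p \<and> fst p + snd p \<le> M"
  shows "exceptional S"
proof -
  define R where "R = {p \<in> inner_points S. snd p = 1}"
  have sub: "R \<subseteq> (\<lambda>x. (x, 1)) ` {1..M - 2}"
  proof
    fix p assume p: "p \<in> R"
    have "- M < (-1) * fst p + (-1) * snd p"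
      by (rule inner_pointsD_int[of p S]) (use p b in \<open>force simp: R_def\<close>)+
    then show "p \<in> (\<lambda>x. (x, 1)) ` {1..M - 2}" using p I[of p] by (cases p) (auto simp: R_def)
  qed
  have M: "3 \<le> M"
  proof -
    have "- M < (-1) * fst (1::int, 1::int) + (-1) * snd (1::int, 1::int)"
      by (rule inner_pointsD_int[OF P]) (use b in force)+
    then show ?thesis by simp
  qed
  have fin: "finite R" using sub finite_subset by blast
  have "card R \<le> card ((\<lambda>x. (x, 1::int)) ` {1..M - 2})" by (rule card_mono[OF _ sub]) simp
  also have "\<dots> \<le> nat (M - 2)" using card_image_le[of "{1..M - 2}" "\<lambda>x. (x, 1::int)"] by simp
  finally have card: "int (card R) \<le> M - m - 2" using M m by linarith
  show ?thesis
  proof (cases "2 \<le> card R")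
    case True
    then have "shape5 S" unfolding shape5_def using card ends b by (auto simp: R_def)
    then show ?thesis by (blast intro: exceptionalI)
  next
    case False
    have P': "(1, 1) \<in> R" using P by (simp add: R_def)
    have R1: "p = (1, 1)" if "p \<in> R" for p
    proof (rule ccontr)
      assume "p \<noteq> (1, 1)"
      then have "card {p, (1, 1)} = 2" by simp
      moreover have "card {p, (1, 1)} \<le> card R" using that P' fin by (intro card_mono) auto
      ultimately show False using False by simp
    qed
    have "(2, 1) \<notin> R" "(0, 1) \<notin> R" using R1[of "(2,1)"] R1[of "(0,1)"] by auto
    then have "(2, 1) \<notin> inner_points S" "(0, 1) \<notin> inner_points S" by (auto simp: R_def)
    then obtain \<alpha> \<beta> \<alpha>' \<beta>' where
      nz: "\<alpha> \<noteq> 0 \<or> \<beta> \<noteq> 0" "\<alpha>' \<noteq> 0 \<or> \<beta>' \<noteq> 0"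
      and ge: "\<And>q. q \<in> S \<Longrightarrow> 2 * \<alpha> + \<beta> \<le> lin \<alpha> \<beta> q" "\<And>q. q \<in> S \<Longrightarrow> \<beta>' \<le> lin \<alpha>' \<beta>' q"
      by (elim not_inner_pointsE) (simp add: mult.commute)
    have a: "\<alpha> < 0" "0 < \<alpha>'"
      using inner_pointsD[OF P nz(1) ge(1)] inner_pointsD[OF P nz(2) ge(2)] by simp_all
    have c: "\<beta> \<le> \<alpha> * (real_of_int M - 2)" "\<beta>' \<le> \<alpha>' * m"
      using ge(1)[OF ends(2)] ge(2)[OF ends(1)] by (simp_all add: algebra_simps)
    \<comment> \<open>Above row 1 the supporting lines are no looser than the line through (2, 1)
      and (M, 0) on the right and the line through (0, 1) and (m, 0) on the left.\<close>
    have up: "x \<le> 2 - (M - 2) * (y - 1) \<and> - m * (y - 1) \<le> x" if p: "(x, y) \<in> S" "1 \<le> y" for x y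
    proof -
      have y: "0 \<le> real_of_int y - 1" using p(2) by simp
      have "\<beta> * (real_of_int y - 1) \<le> \<alpha> * (real_of_int M - 2) * (real_of_int y - 1)"
        "\<beta>' * (real_of_int y - 1) \<le> \<alpha>' * m * (real_of_int y - 1)"
        using c y by (auto intro: mult_right_mono)
      then have "0 \<le> \<alpha> * (real_of_int x - 2 + (real_of_int M - 2) * (real_of_int y - 1))"
        "0 \<le> \<alpha>' * (real_of_int x + m * (real_of_int y - 1))"
        using ge[OF p(1)] by (auto simp: algebra_simps)
      then have "real_of_int x - 2 + (real_of_int M - 2) * (real_of_int y - 1) \<le> 0"
        "0 \<le> real_of_int x + m * (real_of_int y - 1)"
        using a by (auto simp: zero_le_mult_iff)
      then have "real_of_int (x - 2 + (M - 2) * (y - 1)) \<le> real_of_int 0"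
        "real_of_int 0 \<le> real_of_int (x + m * (y - 1))" by simp_all
      then show ?thesis by linarith
    qed
    define n where "n = M - m"
    \<comment> \<open>The shear makes the left bounding line vertical; the base length n is the only
      parameter left.\<close>
    define \<zeta> where "\<zeta> = (\<lambda>p. (1 * fst p + m * snd p + (- m), 0 * fst p + 1 * snd p + 0))"
    have ze: "umap \<zeta>" unfolding \<zeta>_def by (rule umapI) simp
    define T where "T = \<zeta> ` S"
    have oT: "(0, 0) \<in> T" "(n, 0) \<in> T"
      using ends by (force simp: T_def \<zeta>_def n_def)+
    have bT: "0 \<le> x \<and> 0 \<le> y \<and> (y = 0 \<longrightarrow> x \<le> n) \<and> (1 \<le> y \<longrightarrow> x \<le> 2 - (n - 2) * (y - 1))"
      if "(x, y) \<in> T" for x y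
    proof -
      have q: "(x + m - m * y, y) \<in> S" using that by (force simp: T_def \<zeta>_def)
      show ?thesis using b[OF q] up[OF q] by (cases "y = 0") (auto simp: n_def algebra_simps)
    qed
    \<comment> \<open>Otherwise y <= 1 would hold on all of S, with equality at the interior point
      (1, 1).\<close>
    have "\<exists>q\<in>S. 2 \<le> snd q"
    proof (rule ccontr)
      assume "\<not> ?thesis"
      then have "-1 < 0 * fst (1::int, 1::int) + (-1) * snd (1::int, 1::int)"
        by (intro inner_pointsD_int[OF P]) force+
      then show False by simp
    qed
    then obtain Z where Z: "Z \<in> T" "2 \<le> snd Z" by (force simp: T_def \<zeta>_def)
    have n3: "3 \<le> n" using m by (simp add: n_def)
    have Zb: "0 \<le> fst Z" "fst Z \<le> 2 - (n - 2) * (snd Z - 1)" using bT[of "fst Z" "snd Z"] Z by auto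
    \<comment> \<open>At height 2 or more the right bound must still leave room for x >= 0. This
      forces n <= 4.\<close>
    have "(n - 2) * 1 \<le> (n - 2) * (snd Z - 1)" using n3 Z by (intro mult_left_mono) auto
    also have "\<dots> \<le> 2" using Zb by simp
    finally have "n \<le> 4" by simp
    then have "n = 3 \<or> n = 4" using n3 by linarith
    then have "exceptional T"
    proof
      assume [simp]: "n = 3"
      show ?thesis
      proof (rule triangle_size3_subsets[OF _ _ Z])
        show "(0, 0) \<in> T" "(3, 0) \<in> T" using oT by auto
        show "0 \<le> x \<and> 0 \<le> y \<and> x + y \<le> 3" if "(x, y) \<in> T" for x y
          using bT[OF that] by (cases "y = 0") auto
      qed
    next
      assume [simp]: "n = 4"
      have "Z = (0, 2)" using Zb Z(2) by (cases Z) auto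
      moreover have "fst p + 2 * snd p \<le> 4" if "p \<in> T" for p
        using bT[of "fst p" "snd p"] that by (cases p; cases "snd p = 0") auto
      ultimately have "shape4 T" unfolding shape4_def using oT Z(1) bT by force
      then show ?thesis by (blast intro: exceptionalI)
    qed
    then show ?thesis unfolding T_def by (rule exceptional_image[OF ze])
  qed
qed

text \<open>In either quadrant x and y have compatible signs, so between opposite quadrants the
  spread of x + y is at least that of x. As n bounds the spread of x + y, the points p and q
  realising n in x are pressed onto the row y = 0, up to replacing q by the origin.\<close>

lemma exceptional_of_equal_widths:
  assumes P: "(1, 1) \<in> inner_points S" and I: "\<And>p. p \<in> inner_points S \<Longrightarrow> 1 \<le> fst p \<and> 1 \<le> snd p"
    and Q: "S \<subseteq> quadrants13" and V: "V \<in> S" "fst V + snd V \<le> 0"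
    and w: "\<And>p q. p \<in> S \<Longrightarrow> q \<in> S \<Longrightarrow> fst p + snd p - (fst q + snd q) \<le> n"
    and pq: "p \<in> S" "q \<in> S" "n \<le> fst p - fst q" and n: "3 \<le> n"
  shows "exceptional S"
proof -
  \<comment> \<open>The interior point (1, 1) has sum 2, so some point has a larger one. It keeps p
    out of the third quadrant: q would then have sum at most -n, too far from Z.\<close>
  have "\<exists>Z\<in>S. 3 \<le> fst Z + snd Z"
  proof (rule ccontr)
    assume "\<not> ?thesis"
    then have "-2 < (-1) * fst (1::int, 1::int) + (-1) * snd (1::int, 1::int)"
      by (intro inner_pointsD_int[OF P]) force+
    then show False by simp
  qed
  then obtain Z where Z: "Z \<in> S" "3 \<le> fst Z + snd Z" by blast
  have quad: "0 \<le> fst p \<and> 0 \<le> snd p \<or> fst p \<le> 0 \<and> snd p \<le> 0" if "p \<in> S" for p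
    using that Q by (auto simp: quadrants13_def)
  have "\<exists>m. m \<le> 0 \<and> (m, 0) \<in> S \<and> (m + n, 0) \<in> S"
  proof -
    note qs = quad[OF pq(1)] quad[OF pq(2)] quad[OF V(1)]
    note ws = w[OF pq(1,2)] w[OF pq(1) V(1)] w[OF Z(1) pq(2)]
    have "0 \<le> fst p \<and> 0 \<le> snd p" using qs ws Z(2) pq(3) n by linarith
    then consider "fst q \<le> 0" "snd q \<le> 0" | "0 \<le> fst q" "0 \<le> snd q" using qs by blast
    then show ?thesis
    proof cases
      case 1
      then have "snd q = 0" "snd p = 0" "fst p = fst q + n"
        using \<open>0 \<le> fst p \<and> 0 \<le> snd p\<close> ws(1) pq(3) by linarith+
      then show ?thesis using pq(1,2) 1(1) by (intro exI[of _ "fst q"]) (metis prod.collapse)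
    next
      case 2
      \<comment> \<open>Here V takes the place of q: its sum is at most 0 and that of p at least n,
        so both bounds are attained and V is the origin.\<close>
      then have "fst V + snd V = 0" "snd p = 0" "fst p = n"
        using \<open>0 \<le> fst p \<and> 0 \<le> snd p\<close> ws(2) pq(3) V(2) by linarith+
      moreover from this have "fst V = 0" "snd V = 0" using qs(3) by linarith+
      ultimately show ?thesis using pq(1) V(1) by (intro exI[of _ 0]) (metis add_0 order_refl prod.collapse)
    qed
  qed
  then obtain m where m: "m \<le> 0" "(m, 0) \<in> S" "(m + n, 0) \<in> S" by blast
  have b: "m \<le> fst p + snd p \<and> fst p + snd p \<le> m + n" if "p \<in> S" for p
    using w[OF that m(2)] w[OF m(3) that] by simp
  have up: "0 \<le> snd p" if p: "p \<in> S" for p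
  proof (cases "m = 0")
    case True
    then show ?thesis using b[OF p] quad[OF p] by linarith
  next
    case False
    have "- (m + n) < (-1) * fst (1::int, 1::int) + (-1) * snd (1::int, 1::int)"
      by (rule inner_pointsD_int[OF P]) (use b in force)+
    then have M: "0 < m + n" by simp
    \<comment> \<open>The origin lies strictly between (m, 0) and (m + n, 0) without being interior,
      so the only supporting line through it is the row itself.\<close>
    have "(0, 0) \<notin> inner_points S" using I by force
    then obtain \<alpha> \<beta> where nz: "\<alpha> \<noteq> 0 \<or> \<beta> \<noteq> 0" and ge: "\<And>q. q \<in> S \<Longrightarrow> 0 \<le> lin \<alpha> \<beta> q"
      by (elim not_inner_pointsE) simp
    have "0 \<le> \<alpha> * real_of_int m" "0 \<le> \<alpha> * real_of_int (m + n)"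
      using ge[OF m(2)] ge[OF m(3)] by simp_all
    then have "\<alpha> = 0" using False m(1) M unfolding zero_le_mult_iff by linarith
    then have "0 < \<beta>" using inner_pointsD[OF P nz ge] by simp
    then show ?thesis using ge[OF p] \<open>\<alpha> = 0\<close> by (simp add: lin_def zero_le_mult_iff)
  qed
  show ?thesis by (rule exceptional_of_long_row[OF P I m(2,3,1)]) (use b up n in auto)
qed

text \<open>Measuring only the second coordinate loses nothing, since \<open>snd\<close> after a
  \<open>umap\<close> runs through all primitive integral coordinate functions.\<close>

definition height_le :: "int \<Rightarrow> (int \<times> int) set \<Rightarrow> bool" where
  "height_le n S \<longleftrightarrow> (\<forall>p\<in>S. \<forall>q\<in>S. snd p - snd q \<le> n)"

lemma height_le_image: "height_le n (\<psi> ` S) \<longleftrightarrow> (\<forall>p\<in>S. \<forall>q\<in>S. snd (\<psi> p) - snd (\<psi> q) \<le> n)"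
  by (simp add: height_le_def)

lemma exceptional_of_minimal_height:
  assumes fin: "finite S" and d: "0 \<le> d" and nf: "\<not> fits_square (d + 2) S"
    and hI: "height_le d (inner_points S)" and hS: "height_le n S" "d + 3 \<le> n"
    and min: "\<And>\<psi>. umap \<psi> \<Longrightarrow> height_le d (\<psi> ` inner_points S) \<Longrightarrow> \<not> height_le (d + 2) (\<psi> ` S) \<Longrightarrow>
      \<not> height_le (n - 1) (\<psi> ` S)"
    and P: "P \<in> inner_points S" and V: "V \<in> S" "snd V \<le> snd P - 2"
    and low: "\<And>p. p \<in> inner_points S \<Longrightarrow> snd P \<le> snd p"
  shows "exceptional S"
proof -
  obtain \<psi> where u: "umap \<psi>" and s: "\<And>p. fst (\<psi> p) + snd (\<psi> p) = snd p - snd P + 2" and psiP: "\<psi> P = (1, 1)"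
    and Q: "\<psi> ` S \<subseteq> quadrants13" and I: "\<And>p. p \<in> inner_points (\<psi> ` S) \<Longrightarrow> 1 \<le> fst p \<and> 1 \<le> snd p"
    using wedge[OF P V low] by metis
  note iu = inner_points_image[OF u, of S]
  have P1: "(1, 1) \<in> inner_points (\<psi> ` S)" using P psiP iu by (metis image_eqI)
  have V1: "\<psi> V \<in> \<psi> ` S" "fst (\<psi> V) + snd (\<psi> V) \<le> 0" using V s[of V] by auto
  have w1: "fst p + snd p - (fst q + snd q) \<le> n" if "p \<in> \<psi> ` S" "q \<in> \<psi> ` S" for p q
    using that hS(1) s unfolding height_le_def by force
  \<comment> \<open>The sum is 2 at P, and interior points rise at most d above P. With both
    coordinates at least 1, each of them ranges over [1, d + 1].\<close>
  have dI: "fst p + snd p \<le> d + 2" if "p \<in> inner_points (\<psi> ` S)" for p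
    using that hI P s unfolding iu height_le_def by force
  have us: "umap (prod.swap \<circ> \<psi>)" by (rule umap_comp[OF umap_swap u])
  have h: "height_le d (\<psi> ` inner_points S)" "height_le d ((prod.swap \<circ> \<psi>) ` inner_points S)"
  proof -
    have "\<bar>fst p - fst q\<bar> \<le> d \<and> \<bar>snd p - snd q\<bar> \<le> d"
      if "p \<in> inner_points (\<psi> ` S)" "q \<in> inner_points (\<psi> ` S)" for p q
      using dI[OF that(1)] dI[OF that(2)] I[OF that(1)] I[OF that(2)] by linarith
    then show "height_le d (\<psi> ` inner_points S)" "height_le d ((prod.swap \<circ> \<psi>) ` inner_points S)"
      unfolding iu by (simp_all add: height_le_image abs_le_iff)
  qed
  \<comment> \<open>Two coordinates of width at most d + 2 would exhibit a square of that
    side.\<close>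
  have "\<not> height_le (d + 2) (\<psi> ` S) \<or> \<not> height_le (d + 2) ((prod.swap \<circ> \<psi>) ` S)"
  proof (rule ccontr)
    assume "\<not> ?thesis"
    then have "fits_square (d + 2) (\<psi> ` S)"
      by (intro fits_square_widths) (use fin d in \<open>auto simp: height_le_def\<close>)
    then show False using nf fits_square_image[OF u] by blast
  qed
  then have "exceptional (\<psi> ` S)"
  proof
    assume "\<not> height_le (d + 2) ((prod.swap \<circ> \<psi>) ` S)"
    from min[OF us h(2) this] obtain p q where pq: "p \<in> \<psi> ` S" "q \<in> \<psi> ` S" "n \<le> fst p - fst q"
      unfolding height_le_image by (fastforce simp: not_le)
    show ?thesis
      by (rule exceptional_of_equal_widths[OF P1 I Q V1 w1 pq]) (use hS(2) d in auto)
  next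
    assume "\<not> height_le (d + 2) (\<psi> ` S)"
    from min[OF u h(1) this] obtain p q where pq: "p \<in> \<psi> ` S" "q \<in> \<psi> ` S" "n \<le> snd p - snd q"
      unfolding height_le_image by (fastforce simp: not_le)
    \<comment> \<open>Exchanging the coordinates preserves (1, 1), the sum and the two quadrants, so
      this is the other case again.\<close>
    let ?T = "prod.swap ` \<psi> ` S"
    have i: "inner_points ?T = prod.swap ` inner_points (\<psi> ` S)" by (rule inner_points_image[OF umap_swap])
    have "exceptional ?T"
    proof (rule exceptional_of_equal_widths[of ?T "prod.swap (\<psi> V)" n "prod.swap p" "prod.swap q"])
      show "(1, 1) \<in> inner_points ?T" using P1 unfolding i by force
      show "1 \<le> fst p \<and> 1 \<le> snd p" if "p \<in> inner_points ?T" for p using that I unfolding i by force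
      show "?T \<subseteq> quadrants13" using Q by (force simp: quadrants13_def)
      show "fst r + snd r - (fst t + snd t) \<le> n" if "r \<in> ?T" "t \<in> ?T" for r t
        using that w1 by (force simp: add.commute)
    qed (use V1 pq hS(2) d in auto)
    then show ?thesis by (rule exceptional_image[OF umap_swap])
  qed
  then show ?thesis by (rule exceptional_image[OF u])
qed

theorem exceptional_if_not_fits:
  assumes fin: "finite S" and ne: "inner_points S \<noteq> {}" and finI: "finite (inner_points S)"
    and d: "0 \<le> d" and fI: "fits_square d (inner_points S)" and nf: "\<not> fits_square (d + 2) S"
  shows "exceptional S"
proof -
  \<comment> \<open>Since \<open>?W n\<close> only bounds the width by n, it is monotone in n, and
    its least solution is the minimal width of an admissible coordinate function.\<close>
  let ?W = "\<lambda>n. \<exists>\<psi>. umap \<psi> \<and> height_le d (\<psi> ` inner_points S) \<and> height_le (int n) (\<psi> ` S) \<and> \<not> height_le (d + 2) (\<psi> ` S)"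
  have "\<exists>n. ?W n"
  proof -
    obtain \<psi> where u: "umap \<psi>" and b: "\<And>p. p \<in> inner_points S \<Longrightarrow>
        0 \<le> fst (\<psi> p) \<and> fst (\<psi> p) \<le> d \<and> 0 \<le> snd (\<psi> p) \<and> snd (\<psi> p) \<le> d"
      using fI fits_squareE by metis
    \<comment> \<open>Both coordinates of a square around the interior points are narrow there; they
      cannot both be narrow on S, or S would fit into side d + 2.\<close>
    have "\<exists>\<xi>. umap \<xi> \<and> height_le d (\<xi> ` inner_points S) \<and> \<not> height_le (d + 2) (\<xi> ` S)"
    proof (rule ccontr)
      assume no: "\<not> ?thesis"
      have "\<bar>fst (\<psi> p) - fst (\<psi> q)\<bar> \<le> d \<and> \<bar>snd (\<psi> p) - snd (\<psi> q)\<bar> \<le> d"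
        if "p \<in> inner_points S" "q \<in> inner_points S" for p q
        using b[OF that(1)] b[OF that(2)] by linarith
      then have "height_le d (\<psi> ` inner_points S)" "height_le d ((prod.swap \<circ> \<psi>) ` inner_points S)"
        by (simp_all add: height_le_image abs_le_iff)
      then have "height_le (d + 2) (\<psi> ` S)" "height_le (d + 2) ((prod.swap \<circ> \<psi>) ` S)"
        using no u umap_comp[OF umap_swap u] by blast+
      then have "fits_square (d + 2) (\<psi> ` S)"
        by (intro fits_square_widths) (use fin d in \<open>auto simp: height_le_def\<close>)
      then show False using nf fits_square_image[OF u] by blast
    qed
    then obtain \<xi> where x: "umap \<xi>" "height_le d (\<xi> ` inner_points S)" "\<not> height_le (d + 2) (\<xi> ` S)"
      by blast
    have "finite (snd ` \<xi> ` S)" using fin by simp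
    then have "finite ((\<lambda>(a, b). a - b) ` (snd ` \<xi> ` S \<times> snd ` \<xi> ` S))" by blast
    then obtain B where "\<And>z. z \<in> (\<lambda>(a, b). a - b) ` (snd ` \<xi> ` S \<times> snd ` \<xi> ` S) \<Longrightarrow> z \<le> B"
      by (meson bdd_above_finite bdd_above.E)
    then have "height_le (int (nat B)) (\<xi> ` S)" unfolding height_le_def by force
    then show ?thesis using x by blast
  qed
  then have "?W (Least ?W)" by (rule LeastI_ex)
  then obtain \<psi> where u: "umap \<psi>" and h: "height_le d (\<psi> ` inner_points S)"
     "height_le (int (Least ?W)) (\<psi> ` S)" "\<not> height_le (d + 2) (\<psi> ` S)" by blast
  define n where "n = int (Least ?W)"
  have n: "d + 3 \<le> n" using h(2,3) unfolding n_def height_le_def by force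
  have min: "\<not> height_le (n - 1) (\<xi> ` S)"
    if "umap \<xi>" "height_le d (\<xi> ` inner_points S)" "\<not> height_le (d + 2) (\<xi> ` S)" for \<xi>
  proof
    assume "height_le (n - 1) (\<xi> ` S)"
    then have "?W (nat (n - 1))" using that n d by auto
    then have "Least ?W \<le> nat (n - 1)" by (rule Least_le)
    then show False using n d unfolding n_def by linarith
  qed
  \<comment> \<open>stated for an arbitrary map, so that reflecting \<open>\<psi>\<close> covers protrusion at the top\<close>
  have exc: "exceptional (\<psi>' ` S)"
    if u': "umap \<psi>'" and h': "height_le d (\<psi>' ` inner_points S)" "height_le n (\<psi>' ` S)"
      and P: "P \<in> inner_points S" and V: "V \<in> S" "snd (\<psi>' V) \<le> snd (\<psi>' P) - 2"
      and low: "\<And>p. p \<in> inner_points S \<Longrightarrow> snd (\<psi>' P) \<le> snd (\<psi>' p)" for \<psi>' P V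
  proof (rule exceptional_of_minimal_height[where d = d and n = n and P = "\<psi>' P" and V = "\<psi>' V"])
    note i = inner_points_image[OF u', of S]
    show "finite (\<psi>' ` S)" "0 \<le> d" "height_le n (\<psi>' ` S)" "d + 3 \<le> n" "\<psi>' V \<in> \<psi>' ` S"
      "snd (\<psi>' V) \<le> snd (\<psi>' P) - 2"
      using fin d h' n V by auto
    show "\<not> fits_square (d + 2) (\<psi>' ` S)" using nf fits_square_image[OF u'] by blast
    show "height_le d (inner_points (\<psi>' ` S))" "\<psi>' P \<in> inner_points (\<psi>' ` S)" using h' P i by auto
    show "snd (\<psi>' P) \<le> snd p" if "p \<in> inner_points (\<psi>' ` S)" for p using that low i by auto
    show "\<not> height_le (n - 1) (\<xi> ` \<psi>' ` S)"
      if "umap \<xi>" "height_le d (\<xi> ` inner_points (\<psi>' ` S))" "\<not> height_le (d + 2) (\<xi> ` \<psi>' ` S)" for \<xi>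
      using min[OF umap_comp[OF that(1) u']] that(2,3) i by (simp add: image_comp)
  qed
  obtain P where P: "P \<in> inner_points S" "\<And>p. p \<in> inner_points S \<Longrightarrow> snd (\<psi> P) \<le> snd (\<psi> p)"
    using ex_minimizer[OF finI ne, of "\<lambda>p. snd (\<psi> p)"] by blast
  obtain P' where P': "P' \<in> inner_points S" "\<And>p. p \<in> inner_points S \<Longrightarrow> snd (\<psi> p) \<le> snd (\<psi> P')"
    using ex_minimizer[OF finI ne, of "\<lambda>p. - snd (\<psi> p)"] by auto
  have PP: "snd (\<psi> P') - snd (\<psi> P) \<le> d" using h(1) P(1) P'(1) unfolding height_le_def by blast
  obtain p q where pq: "p \<in> S" "q \<in> S" "d + 2 < snd (\<psi> p) - snd (\<psi> q)"
    using h(3) unfolding height_le_def by (auto simp: not_le)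
  \<comment> \<open>The spread on S is at least d + 3 and that of the interior points at most d, so
    the overhangs below and above add up to at least 3 and one of them is at least 2.\<close>
  then consider "snd (\<psi> q) \<le> snd (\<psi> P) - 2" | "snd (\<psi> P') + 2 \<le> snd (\<psi> p)" using PP by linarith
  then show ?thesis
  proof cases
    case 1
    show ?thesis
      by (rule exceptional_image[OF u], rule exc[OF u h(1) h(2)[folded n_def] P(1) pq(2) 1 P(2)])
  next
    case 2
    define \<rho> where "\<rho> = (\<lambda>p::int \<times> int. (1 * fst p + 0 * snd p + 0, 0 * fst p + (-1) * snd p + 0))"
    have r: "umap \<rho>" unfolding \<rho>_def by (rule umapI) simp
    have s: "snd (\<rho> p) = - snd p" for p by (simp add: \<rho>_def)
    note ru = umap_comp[OF r u]
    have hh: "height_le k ((\<rho> \<circ> \<psi>) ` T)" if "height_le k (\<psi> ` T)" for k T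
      using that unfolding height_le_def by (auto simp: s)
    show ?thesis
      by (rule exceptional_image[OF ru], rule exc[OF ru hh[OF h(1)] hh[OF h(2)[folded n_def]] P'(1) pq(1)])
        (use 2 P'(2) s in auto)
  qed
qed

subsection \<open>Hollow polygons\<close>

definition collinear_pts :: "(int \<times> int) set \<Rightarrow> bool" where
  "collinear_pts S \<longleftrightarrow> (\<exists>a b c. (a \<noteq> 0 \<or> b \<noteq> 0) \<and> (\<forall>p\<in>S. a * fst p + b * snd p = c))"

lemma collinear_pts_image:
  assumes "umap \<psi>" "collinear_pts (\<psi> ` S)"
  shows "collinear_pts S"
proof -
  obtain a b c where ab: "a \<noteq> 0 \<or> b \<noteq> 0" and l: "\<And>p. p \<in> S \<Longrightarrow> a * fst (\<psi> p) + b * snd (\<psi> p) = c"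
    using assms(2) unfolding collinear_pts_def by auto
  obtain a1 b1 c1 d1 e1 f1 where 1: "\<bar>a1 * d1 - b1 * c1\<bar> = 1"
    and psi: "\<psi> = (\<lambda>p. (a1 * fst p + b1 * snd p + e1, c1 * fst p + d1 * snd p + f1))"
    using assms unfolding umap_def by blast
  have "d1 * (a * a1 + b * c1) - c1 * (a * b1 + b * d1) = a * (a1 * d1 - b1 * c1)"
       "a1 * (a * b1 + b * d1) - b1 * (a * a1 + b * c1) = b * (a1 * d1 - b1 * c1)"
    by (simp_all add: algebra_simps)
  then have "a * a1 + b * c1 \<noteq> 0 \<or> a * b1 + b * d1 \<noteq> 0" using ab 1 by auto
  moreover have "(a * a1 + b * c1) * fst p + (a * b1 + b * d1) * snd p = c - a * e1 - b * f1" if "p \<in> S" for p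
    using l[OF that] by (simp add: psi algebra_simps)
  ultimately show ?thesis unfolding collinear_pts_def by blast
qed

text \<open>One step of gift wrapping from a lowest point A. If A is the only lowest point, B
  maximises the quotient dx/dy as seen from A. The inequality is a cross product: S lies to the left
  of the directed line from A to B.\<close>

lemma ex_supporting_pair:
  assumes fin: "finite S" and nc: "\<not> collinear_pts S"
  obtains A B where "A \<in> S" "B \<in> S" "A \<noteq> B"
    "\<And>p. p \<in> S \<Longrightarrow> 0 \<le> (fst B - fst A) * (snd p - snd A) - (snd B - snd A) * (fst p - fst A)"
proof -
  have ne: "S \<noteq> {}" using nc unfolding collinear_pts_def by (metis empty_iff zero_neq_one)
  obtain A where A: "A \<in> S" "\<And>p. p \<in> S \<Longrightarrow> snd A \<le> snd p"
    using ex_minimizer[OF fin ne, of snd] by blast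
  show thesis
  proof (cases "\<exists>B\<in>S. snd B = snd A \<and> B \<noteq> A")
    case True
    then obtain B where B: "B \<in> S" "snd B = snd A" "B \<noteq> A" by blast
    then have "fst B \<noteq> fst A" by (auto simp: prod_eq_iff)
    then consider "fst A < fst B" | "fst B < fst A" by linarith
    then show thesis
    proof cases
      case 1
      show thesis by (rule that[OF A(1) B(1)]) (use 1 A(2) B in auto)
    next
      case 2
      show thesis by (rule that[OF B(1) A(1)]) (use 2 A(2) B in auto)
    qed
  next
    case False
    have "S - {A} \<noteq> {}"
    proof
      assume "S - {A} = {}"
      then have "\<forall>p\<in>S. 0 * fst p + 1 * snd p = snd A" by auto
      then show False using nc unfolding collinear_pts_def by (metis zero_neq_one)
    qed
    then obtain B where B: "B \<in> S - {A}" and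
      min: "\<And>p. p \<in> S - {A} \<Longrightarrow>
        - (real_of_int (fst B - fst A) / of_int (snd B - snd A)) \<le> - (of_int (fst p - fst A) / of_int (snd p - snd A))"
      using ex_minimizer[of "S - {A}" "\<lambda>p. - (real_of_int (fst p - fst A) / of_int (snd p - snd A))"] fin
      by blast
    have pos: "snd A < snd p" if "p \<in> S - {A}" for p using that A(2)[of p] False by force
    show thesis
    proof (rule that[OF A(1), of B])
      fix p assume p: "p \<in> S"
      show "0 \<le> (fst B - fst A) * (snd p - snd A) - (snd B - snd A) * (fst p - fst A)"
      proof (cases "p = A")
        case False
        then have "real_of_int (fst p - fst A) * of_int (snd B - snd A) \<le> of_int (fst B - fst A) * of_int (snd p - snd A)"
          using min[of p] pos[of p] pos[OF B] p by (simp add: field_simps)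
        then have "(fst p - fst A) * (snd B - snd A) \<le> (fst B - fst A) * (snd p - snd A)"
          by (simp only: of_int_mult[symmetric] of_int_le_iff)
        then show ?thesis by (simp add: mult.commute)
      qed simp
    qed (use B in auto)
  qed
qed

text \<open>Dividing B - A by its gcd gives a primitive direction, which Bezout completes to a
  unimodular matrix. The new second coordinate is the cross product divided by the gcd, hence
  non-negative.\<close>

lemma ex_supporting_row:
  assumes fin: "finite S" and nc: "\<not> collinear_pts S"
  obtains \<psi> L where "umap \<psi>" "1 \<le> L" "(0, 0) \<in> \<psi> ` S" "(L, 0) \<in> \<psi> ` S" "\<And>p. p \<in> \<psi> ` S \<Longrightarrow> 0 \<le> snd p"
    "\<And>x. (x, 0) \<in> \<psi> ` S \<Longrightarrow> 0 \<le> x \<and> x \<le> L"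
proof -
  obtain A B where A: "A \<in> S" "B \<in> S" "A \<noteq> B"
    and sup: "\<And>p. p \<in> S \<Longrightarrow> 0 \<le> (fst B - fst A) * (snd p - snd A) - (snd B - snd A) * (fst p - fst A)"
    using ex_supporting_pair[OF assms] by metis
  define g where "g = gcd (fst B - fst A) (snd B - snd A)"
  have g: "0 < g" using A(3) by (auto simp: g_def prod_eq_iff)
  obtain a b where ab: "fst B - fst A = g * a" "snd B - snd A = g * b"
    unfolding g_def by (meson dvdE gcd_dvd1 gcd_dvd2)
  obtain s t where "s * (fst B - fst A) + t * (snd B - snd A) = g"
    using bezout_int[of "fst B - fst A" "snd B - snd A"] unfolding g_def by blast
  then have "s * (g * a) + t * (g * b) = g" by (simp only: ab)
  then have "g * (s * a + t * b) = g * 1" by (simp add: algebra_simps)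
  then have st: "s * a + t * b = 1" using g by simp
  define \<psi> where "\<psi> = (\<lambda>p. (s * fst p + t * snd p + (- s * fst A - t * snd A), (- b) * fst p + a * snd p + (b * fst A - a * snd A)))"
  have u: "umap \<psi>" unfolding \<psi>_def by (rule umapI) (use st in \<open>simp add: algebra_simps\<close>)
  have nn: "0 \<le> snd p" if p: "p \<in> \<psi> ` S" for p
  proof -
    obtain q where q: "q \<in> S" "p = \<psi> q" using p by blast
    have "g * snd (\<psi> q) = (fst B - fst A) * (snd q - snd A) - (snd B - snd A) * (fst q - fst A)"
      unfolding ab by (simp add: \<psi>_def algebra_simps)
    then have "0 \<le> g * snd (\<psi> q)" using sup[OF q(1)] by simp
    then show ?thesis using g q(2) by (simp add: zero_le_mult_iff)
  qed
  have psiA: "\<psi> A = (0, 0)" by (simp add: \<psi>_def)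
  have B1: "fst B = fst A + g * a" "snd B = snd A + g * b" using ab by auto
  have "\<psi> B = (g * (s * a + t * b), 0)" unfolding \<psi>_def B1 by (simp add: algebra_simps)
  then have psiB: "\<psi> B = (g, 0)" using st by simp
  define R where "R = {x. (x, 0) \<in> \<psi> ` S}"
  have "x \<in> fst ` \<psi> ` S" if "x \<in> R" for x
    using imageI[of "(x, 0)" "\<psi> ` S" fst] that by (simp add: R_def)
  then have "R \<subseteq> fst ` \<psi> ` S" by blast
  then have fR: "finite R" using fin finite_subset by blast
  have oR: "0 \<in> R" "g \<in> R" using A psiA psiB unfolding R_def by (metis image_eqI mem_Collect_eq)+
  \<comment> \<open>A and B need not be the ends of their row, so the row is measured afresh and its
    left end moved to 0.\<close>
  define l r where "l = Min R" and "r = Max R"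
  have lr: "l \<in> R" "r \<in> R" "\<And>x. x \<in> R \<Longrightarrow> l \<le> x \<and> x \<le> r"
    using fR oR by (auto simp: l_def r_def intro: Min_in Max_in)
  define \<tau> where "\<tau> = (\<lambda>p::int \<times> int. (1 * fst p + 0 * snd p + (- l), 0 * fst p + 1 * snd p + 0))"
  have t: "umap \<tau>" unfolding \<tau>_def by (rule umapI) simp
  show thesis
  proof (rule that[OF umap_comp[OF t u], of "r - l"])
    show "1 \<le> r - l" using lr(3)[OF oR(1)] lr(3)[OF oR(2)] g by linarith
    have mem: "(x, y) \<in> (\<tau> \<circ> \<psi>) ` S \<longleftrightarrow> (x + l, y) \<in> \<psi> ` S" for x y
    proof -
      have "(x, y) = \<tau> q \<longleftrightarrow> q = (x + l, y)" for q by (cases q) (auto simp: \<tau>_def)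
      then show ?thesis unfolding image_comp[symmetric] by (metis image_iff)
    qed
    show "(0, 0) \<in> (\<tau> \<circ> \<psi>) ` S" "(r - l, 0) \<in> (\<tau> \<circ> \<psi>) ` S" using lr unfolding mem R_def by simp_all
    show "0 \<le> x \<and> x \<le> r - l" if "(x, 0) \<in> (\<tau> \<circ> \<psi>) ` S" for x
      using lr(3)[of "x + l"] that unfolding mem R_def by simp
    show "0 \<le> snd p" if "p \<in> (\<tau> \<circ> \<psi>) ` S" for p
      using that nn[of "(fst p + l, snd p)"] mem[of "fst p" "snd p"] by simp
  qed
qed

section \<open>Classification of hollow lattice polygons\<close>

definition strip :: "(int \<times> int) set \<Rightarrow> bool" where
  "strip S \<longleftrightarrow> (\<exists>\<psi>. umap \<psi> \<and> (\<forall>p\<in>S. 0 \<le> snd (\<psi> p) \<and> snd (\<psi> p) \<le> 1))"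

definition shape2 :: "(int \<times> int) set \<Rightarrow> bool" where
  "shape2 S \<longleftrightarrow> {(0, 0), (2, 0), (0, 2)} \<subseteq> S \<and> (\<forall>p\<in>S. 0 \<le> fst p \<and> 0 \<le> snd p \<and> fst p + snd p \<le> 2)"

lemma strip_image: "umap \<psi> \<Longrightarrow> strip (\<psi> ` S) \<Longrightarrow> strip S"
  unfolding strip_def using umap_comp by (metis comp_apply image_eqI)

text \<open>The column x = 0 has points of S on both sides of (0, 1), so the supporting line there
  is the column itself. The line at (1, 1), constrained by (1, 0) and (0, h), excludes x > 1 on
  every row above the base. The base is bounded by assumption, so S occupies two adjacent
  columns.\<close>

lemma hollow_strip:
  assumes hol: "inner_points S = {}" and S: "(0, 0) \<in> S" "(1, 0) \<in> S" "(0, h) \<in> S" and h: "2 \<le> h"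
    and up: "\<And>p. p \<in> S \<Longrightarrow> 0 \<le> snd p" and row: "\<And>x. (x, 0) \<in> S \<Longrightarrow> 0 \<le> x \<and> x \<le> 1"
  shows "strip S"
proof -
  have "(0, 1) \<notin> inner_points S" "(1, 1) \<notin> inner_points S" using hol by auto
  then obtain \<alpha> \<beta> \<alpha>' \<beta>' where
    nz: "\<alpha> \<noteq> 0 \<or> \<beta> \<noteq> 0" "\<alpha>' \<noteq> 0 \<or> \<beta>' \<noteq> 0"
    and ge: "\<And>q. q \<in> S \<Longrightarrow> \<beta> \<le> lin \<alpha> \<beta> q" "\<And>q. q \<in> S \<Longrightarrow> \<alpha>' + \<beta>' \<le> lin \<alpha>' \<beta>' q"
    by (elim not_inner_pointsE) simp
  have h': "2 \<le> real_of_int h" using h by simp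
  have "\<beta> \<le> 0" "0 \<le> \<beta> * (real_of_int h - 1)" using ge(1)[OF S(1)] ge(1)[OF S(3)] by (auto simp: algebra_simps)
  then have b0: "\<beta> = 0" using h' by (auto simp: zero_le_mult_iff)
  then have a: "0 < \<alpha>" using ge(1)[OF S(2)] nz(1) by auto
  have b': "\<beta>' \<le> 0" and "\<alpha>' \<le> \<beta>' * (real_of_int h - 1)"
    using ge(2)[OF S(2)] ge(2)[OF S(3)] by (auto simp: algebra_simps)
  moreover have "\<beta>' * (real_of_int h - 2) \<le> 0" using b' h' by (simp add: mult_le_0_iff)
  then have "\<beta>' * (real_of_int h - 1) \<le> \<beta>'" by (simp add: algebra_simps)
  ultimately have le: "\<alpha>' \<le> \<beta>'" by linarith
  have a': "\<alpha>' < 0"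
  proof (rule ccontr)
    assume "\<not> \<alpha>' < 0"
    then have "\<alpha>' = 0" "\<beta>' = 0" using b' le by linarith+
    then show False using nz(2) by blast
  qed
  have "0 \<le> x \<and> x \<le> 1" if p: "(x, y) \<in> S" for x y
  proof (cases "y = 0")
    case True
    then show ?thesis using row p by blast
  next
    case False
    then have y: "1 \<le> real_of_int y" using up[OF p] by simp
    have "0 \<le> \<alpha> * x" using ge(1)[OF p] b0 by simp
    then have "0 \<le> x" using a by (simp add: zero_le_mult_iff)
    have "0 \<le> \<alpha>' * (real_of_int x - 1) + \<beta>' * (real_of_int y - 1)" using ge(2)[OF p] by (simp add: algebra_simps)
    moreover have "\<beta>' * (real_of_int y - 1) \<le> 0" using b' y by (simp add: mult_le_0_iff)
    ultimately have "0 \<le> \<alpha>' * (real_of_int x - 1)" by linarith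
    then have "real_of_int x \<le> 1" using a' by (simp add: zero_le_mult_iff)
    then show ?thesis using \<open>0 \<le> x\<close> by simp
  qed
  then have "\<forall>p\<in>S. 0 \<le> snd (prod.swap p) \<and> snd (prod.swap p) \<le> 1" by auto
  then show ?thesis unfolding strip_def using umap_swap by blast
qed

theorem hollow_cases:
  assumes fin: "finite S" and nc: "\<not> collinear_pts S" and hol: "inner_points S = {}"
  shows "strip S \<or> (\<exists>\<psi>. umap \<psi> \<and> shape2 (\<psi> ` S))"
proof -
  obtain \<psi>0 L where u0: "umap \<psi>0" and L: "1 \<le> L" and r0: "(0, 0) \<in> \<psi>0 ` S" "(L, 0) \<in> \<psi>0 ` S"
    and up0: "\<And>p. p \<in> \<psi>0 ` S \<Longrightarrow> 0 \<le> snd p" and row0: "\<And>x. (x, 0) \<in> \<psi>0 ` S \<Longrightarrow> 0 \<le> x \<and> x \<le> L"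
    using ex_supporting_row[OF fin nc] by metis
  show ?thesis
  proof (cases "\<exists>Z\<in>\<psi>0 ` S. 2 \<le> snd Z")
    case False
    have "0 \<le> snd (\<psi>0 p) \<and> snd (\<psi>0 p) \<le> 1" if "p \<in> S" for p
      using False up0[OF imageI[OF that]] that by (auto simp: not_le)
    then show ?thesis unfolding strip_def using u0 by blast
  next
    case True
    then obtain z0 h where Z0: "(z0, h) \<in> \<psi>0 ` S" and h: "2 \<le> h" by (metis prod.collapse)
    \<comment> \<open>Shearing along the base brings the apex to 0 <= z < h.\<close>
    define c where "c = z0 div h"
    define z where "z = z0 mod h"
    have z: "0 \<le> z" "z < h" using h by (auto simp: z_def)
    have zz: "z0 = c * h + z" unfolding c_def z_def by (rule div_mult_mod_eq[symmetric])
    define \<tau> where "\<tau> = (\<lambda>p::int \<times> int. (1 * fst p + (- c) * snd p + 0, 0 * fst p + 1 * snd p + 0))"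
    have t: "umap \<tau>" unfolding \<tau>_def by (rule umapI) simp
    define \<psi> where "\<psi> = \<tau> \<circ> \<psi>0"
    have u: "umap \<psi>" unfolding \<psi>_def by (rule umap_comp[OF t u0])
    define T where "T = \<psi> ` S"
    have T: "T = \<tau> ` \<psi>0 ` S" by (simp add: T_def \<psi>_def image_comp)
    have mem: "(x, y) \<in> T \<longleftrightarrow> (x + c * y, y) \<in> \<psi>0 ` S" for x y
    proof -
      have "(x, y) = \<tau> q \<longleftrightarrow> q = (x + c * y, y)" for q by (cases q) (auto simp: \<tau>_def)
      then show ?thesis unfolding T by (metis image_iff)
    qed
    have oT: "(0, 0) \<in> T" "(L, 0) \<in> T" "(z, h) \<in> T"
      using r0 Z0 by (auto simp: mem zz add.commute)
    have up: "0 \<le> snd p" if "p \<in> T" for p using that up0[of "(fst p + c * snd p, snd p)"] mem[of "fst p" "snd p"] by simp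
    have row: "0 \<le> x \<and> x \<le> L" if "(x, 0) \<in> T" for x using that row0 mem by simp
    have holT: "inner_points T = {}" using inner_points_image[OF u] hol by (simp add: T_def)
    have "(1, 1) \<notin> inner_points T" using holT by auto
    then obtain \<alpha> \<beta> where nz: "\<alpha> \<noteq> 0 \<or> \<beta> \<noteq> 0" and ge: "\<And>q. q \<in> T \<Longrightarrow> \<alpha> + \<beta> \<le> lin \<alpha> \<beta> q"
      by (elim not_inner_pointsE) simp
    \<comment> \<open>On row 1 the triangle (0, 0), (L, 0), (z, h) extends from z/h to (z + L (h -
      1))/h. As z < h, the point (1, 1) avoids its interior only if the right end is at most
      1.\<close>
    have key: "z + L * (h - 1) \<le> h"
    proof (rule ccontr)
      assume "\<not> ?thesis"
      then have k: "real_of_int h < z + L * (real_of_int h - 1)"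
        by (metis not_le of_int_1 of_int_add of_int_diff of_int_less_iff of_int_mult)
      have rh: "2 \<le> real_of_int h" "real_of_int z < h" "1 \<le> real_of_int L" using h z L by auto
      have f: "\<alpha> + \<beta> \<le> 0" "\<alpha> + \<beta> \<le> \<alpha> * L" "\<alpha> + \<beta> \<le> \<alpha> * z + \<beta> * h"
        using ge[OF oT(1)] ge[OF oT(2)] ge[OF oT(3)] by auto
      have f1: "(\<alpha> + \<beta>) * (real_of_int h - 1) \<le> 0" using f(1) rh by (simp add: mult_le_0_iff)
      have f2: "(\<alpha> + \<beta>) * (real_of_int h - 1) \<le> \<alpha> * L * (real_of_int h - 1)" using f(2) rh by (intro mult_right_mono) auto
      have "0 \<le> \<alpha> * (real_of_int z - h)" using f(3) f1 by (simp add: algebra_simps)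
      then have a0: "\<alpha> \<le> 0" using rh by (auto simp: zero_le_mult_iff)
      have "0 \<le> \<alpha> * (z + L * (real_of_int h - 1) - h)" using f(3) f2 by (simp add: algebra_simps)
      then have "0 \<le> \<alpha>" using k by (auto simp: zero_le_mult_iff)
      then have "\<alpha> = 0" using a0 by simp
      then have "\<beta> \<le> 0" "0 \<le> \<beta> * (real_of_int h - 1)" using f by (auto simp: algebra_simps)
      then show False using rh nz \<open>\<alpha> = 0\<close> by (auto simp: zero_le_mult_iff)
    qed
    have "L < 3"
    proof (rule ccontr)
      assume "\<not> L < 3"
      then have "3 * (h - 1) \<le> L * (h - 1)" using h by (intro mult_right_mono) auto
      also have "\<dots> \<le> h" using key z by simp
      finally show False using h by simp
    qed
    then have "L = 1 \<or> L = 2" using L by linarith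
    then show ?thesis
    proof
      assume L1: "L = 1"
      then have "z = 0 \<or> z = 1" using key z by auto
      then have "strip T"
      proof
        assume "z = 0"
        show ?thesis by (rule hollow_strip[OF holT, of h]) (use oT row up h L1 \<open>z = 0\<close> in auto)
      next
        assume "z = 1"
        \<comment> \<open>Reversing the base moves the apex (1, h) above the origin.\<close>
        define \<rho> where "\<rho> = (\<lambda>p::int \<times> int. ((-1) * fst p + 0 * snd p + 1, 0 * fst p + 1 * snd p + 0))"
        have r: "umap \<rho>" unfolding \<rho>_def by (rule umapI) simp
        have memr: "(x, y) \<in> \<rho> ` T \<longleftrightarrow> (1 - x, y) \<in> T" for x y
        proof -
          have "(x, y) = \<rho> q \<longleftrightarrow> q = (1 - x, y)" for q by (cases q) (auto simp: \<rho>_def)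
          then show ?thesis by (metis image_iff)
        qed
        have "strip (\<rho> ` T)"
        proof (rule hollow_strip[of _ h])
          show "inner_points (\<rho> ` T) = {}" using inner_points_image[OF r] holT by simp
          show "(0, 0) \<in> \<rho> ` T" "(1, 0) \<in> \<rho> ` T" "(0, h) \<in> \<rho> ` T" "2 \<le> h"
            using oT L1 \<open>z = 1\<close> h by (simp_all add: memr)
          show "0 \<le> snd p" if "p \<in> \<rho> ` T" for p
            using that up[of "(1 - fst p, snd p)"] memr[of "fst p" "snd p"] by simp
          show "0 \<le> x \<and> x \<le> 1" if "(x, 0) \<in> \<rho> ` T" for x
            using row[of "1 - x"] that L1 by (simp add: memr)
        qed
        then show ?thesis by (rule strip_image[OF r])
      qed
      then show ?thesis using strip_image[OF u] T_def by blast
    next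
      assume L2: "L = 2"
      \<comment> \<open>The bound leaves (0, 2) as the only apex; the supporting lines at (0, 1) and
        (1, 1) then have to be the other two sides of the triangle.\<close>
      then have hz: "h = 2" "z = 0" using key z h by auto
      have "(0, 1) \<notin> inner_points T" using holT by auto
      then obtain \<alpha>' \<beta>' where nz': "\<alpha>' \<noteq> 0 \<or> \<beta>' \<noteq> 0" and ge': "\<And>q. q \<in> T \<Longrightarrow> \<beta>' \<le> lin \<alpha>' \<beta>' q"
        by (elim not_inner_pointsE) simp
      have "\<beta>' = 0" using ge'[OF oT(1)] ge'[OF oT(3)] hz by simp
      then have a': "0 < \<alpha>'" using ge'[OF oT(2)] L2 nz' by simp
      have ab: "\<alpha> = \<beta>" "\<alpha> + \<beta> \<le> 0" using ge[OF oT(1)] ge[OF oT(2)] ge[OF oT(3)] hz L2 by auto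
      then have a: "\<alpha> < 0" using nz by auto
      have "0 \<le> fst p \<and> fst p + snd p \<le> 2" if "p \<in> T" for p
      proof -
        have "0 \<le> \<alpha>' * fst p" using ge'[OF that] \<open>\<beta>' = 0\<close> by (simp add: lin_def)
        moreover have "0 \<le> \<alpha> * (real_of_int (fst p + snd p) - 2)" using ge[OF that] ab(1) by (simp add: lin_def algebra_simps)
        then have "real_of_int (fst p + snd p) \<le> 2" using a by (simp add: zero_le_mult_iff)
        ultimately show ?thesis using a' by (simp add: zero_le_mult_iff)
      qed
      then have "shape2 T" unfolding shape2_def using oT up hz L2 by auto
      then show ?thesis using u T_def by blast
    qed
  qed
qed

subsection \<open>From integer pairs to the plane\<close>

definition lvec :: "real \<Rightarrow> real \<Rightarrow> real^2" where
  "lvec \<alpha> \<beta> = vector [\<alpha>, \<beta>]"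

definition emb :: "int \<times> int \<Rightarrow> real^2" where
  "emb p = vector [of_int (fst p), of_int (snd p)]"

definition lattice_size :: "(int \<times> int) set \<Rightarrow> int" where
  "lattice_size S = (if S = {} then -1 else int (LEAST d::nat. fits_square (int d) S))"

lemma emb_nth [simp]: "emb p $ 1 = of_int (fst p)" "emb p $ 2 = of_int (snd p)"
  by (simp_all add: emb_def)

lemma inner_lvec: "lvec \<alpha> \<beta> \<bullet> v = \<alpha> * v $ 1 + \<beta> * v $ 2"
  by (simp add: inner_vec_def sum_2 lvec_def)

lemma lvec_eq_0_iff: "lvec \<alpha> \<beta> = 0 \<longleftrightarrow> \<alpha> = 0 \<and> \<beta> = 0"
  by (simp add: vec_eq_iff forall_2 lvec_def)

lemma ex_lvec: "\<exists>\<alpha> \<beta>. v = lvec \<alpha> \<beta>"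
  by (rule exI[of _ "v $ 1"], rule exI[of _ "v $ 2"]) (simp add: vec_eq_iff forall_2 lvec_def)

lemma lin_eq_inner: "lin \<alpha> \<beta> p = lvec \<alpha> \<beta> \<bullet> emb p"
  by (simp add: lin_def inner_lvec)

lemma inj_emb: "inj emb"
proof (rule injI)
  fix p q assume "emb p = emb q"
  then have "emb p $ 1 = emb q $ 1" "emb p $ 2 = emb q $ 2" by simp_all
  then show "p = q" by (simp add: prod_eq_iff)
qed

lemma range_emb: "range emb = lattice_points"
proof
  show "range emb \<subseteq> lattice_points" by (auto simp: lattice_points_def forall_2)
  show "lattice_points \<subseteq> range emb"
  proof
    fix v :: "real^2" assume "v \<in> lattice_points"
    then obtain x y where "v $ 1 = of_int x" "v $ 2 = of_int y"
      unfolding lattice_points_def forall_2 by (auto elim!: Ints_cases)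
    then have "v = emb (x, y)" by (simp add: vec_eq_iff forall_2)
    then show "v \<in> range emb" by blast
  qed
qed

lemma emb_in_lattice [simp]: "emb p \<in> lattice_points"
  using range_emb by blast

lemma lattice_pointsE:
  assumes "v \<in> lattice_points" obtains p where "v = emb p"
  using assms range_emb by blast

lemma lin_ge_hull_iff:
  "(\<forall>q\<in>S. \<gamma> \<le> lin \<alpha> \<beta> q) \<longleftrightarrow> (\<forall>v\<in>convex hull (emb ` S). \<gamma> \<le> lvec \<alpha> \<beta> \<bullet> v)"
proof
  assume "\<forall>q\<in>S. \<gamma> \<le> lin \<alpha> \<beta> q"
  then have "convex hull (emb ` S) \<subseteq> {v. \<gamma> \<le> lvec \<alpha> \<beta> \<bullet> v}"
    by (intro hull_minimal convex_halfspace_ge) (auto simp: lin_eq_inner)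
  then show "\<forall>v\<in>convex hull (emb ` S). \<gamma> \<le> lvec \<alpha> \<beta> \<bullet> v" by blast
next
  assume "\<forall>v\<in>convex hull (emb ` S). \<gamma> \<le> lvec \<alpha> \<beta> \<bullet> v"
  then show "\<forall>q\<in>S. \<gamma> \<le> lin \<alpha> \<beta> q" by (auto simp: lin_eq_inner hull_inc)
qed

lemma inner_points_iff_hull:
  "p \<in> inner_points S \<longleftrightarrow> (\<forall>\<alpha> \<beta>. \<alpha> \<noteq> 0 \<or> \<beta> \<noteq> 0 \<longrightarrow>
      \<not> (\<forall>v\<in>convex hull (emb ` S). lin \<alpha> \<beta> p \<le> lvec \<alpha> \<beta> \<bullet> v))"
  unfolding lin_ge_hull_iff[symmetric] inner_points_def by (auto simp: not_le)

text \<open>Allows interior points of a model polygon to be computed from its vertices, although S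
  will consist of all lattice points of the polygon.\<close>

lemma inner_points_hull_cong:
  "convex hull (emb ` S) = convex hull (emb ` T) \<Longrightarrow> inner_points S = inner_points T"
  by (auto simp: inner_points_iff_hull)

text \<open>Dimension 2 gives a nonempty interior, whose closure is that of the hull. A hyperplane
  separating a point from the interior therefore bounds the whole hull, and this is how membership
  in \<open>inner_points\<close> fails.\<close>

lemma interior_lattice_points:
  assumes dim: "aff_dim (convex hull (emb ` S)) = 2"
  shows "interior (convex hull (emb ` S)) \<inter> lattice_points = emb ` inner_points S"
proof -
  let ?D = "convex hull (emb ` S)"
  have "affine hull ?D = UNIV" using dim aff_dim_eq_full[of ?D] by simp
  then have ne: "interior ?D \<noteq> {}"
    using rel_interior_interior[of ?D] rel_interior_eq_empty[OF convex_convex_hull[of "emb ` S"]] by auto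
  have cl: "closure (interior ?D) = closure ?D"
    using ne by (simp add: convex_closure_interior)
  have "emb p \<in> interior ?D \<longleftrightarrow> p \<in> inner_points S" for p
  proof
    assume p: "emb p \<in> interior ?D"
    show "p \<in> inner_points S" unfolding inner_points_iff_hull
    proof (intro allI impI notI)
      fix \<alpha> \<beta> :: real assume nz: "\<alpha> \<noteq> 0 \<or> \<beta> \<noteq> 0"
        and ge: "\<forall>v\<in>?D. lin \<alpha> \<beta> p \<le> lvec \<alpha> \<beta> \<bullet> v"
      have "?D \<subseteq> {v. lin \<alpha> \<beta> p \<le> lvec \<alpha> \<beta> \<bullet> v}" using ge by blast
      then have "interior ?D \<subseteq> {v. lin \<alpha> \<beta> p < lvec \<alpha> \<beta> \<bullet> v}"
        using interior_mono interior_halfspace_ge[of "lvec \<alpha> \<beta>"] nz lvec_eq_0_iff by metis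
      then show False using p by (auto simp: lin_eq_inner)
    qed
  next
    assume p: "p \<in> inner_points S"
    show "emb p \<in> interior ?D"
    proof (rule ccontr)
      assume "emb p \<notin> interior ?D"
      then obtain a b where ab: "a \<noteq> 0" "a \<bullet> emb p \<le> b" "\<forall>x\<in>interior ?D. b \<le> a \<bullet> x"
        using separating_hyperplane_sets[of "{emb p}" "interior ?D"] ne by (auto simp: convex_interior)
      have "closure (interior ?D) \<subseteq> {x. b \<le> a \<bullet> x}"
        using ab(3) by (intro closure_minimal closed_halfspace_ge) auto
      then have "\<forall>v\<in>?D. a \<bullet> emb p \<le> a \<bullet> v" using cl closure_subset[of ?D] ab(2) by force
      moreover obtain \<alpha> \<beta> where "a = lvec \<alpha> \<beta>" using ex_lvec by blast
      ultimately show False using p ab(1) unfolding inner_points_iff_hull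
        by (auto simp: lin_eq_inner lvec_eq_0_iff)
    qed
  qed
  then show ?thesis unfolding range_emb[symmetric] by auto
qed

lemma interior_polygon_hull:
  "aff_dim (convex hull (emb ` S)) = 2 \<Longrightarrow>
    interior_polygon (convex hull (emb ` S)) = convex hull (emb ` inner_points S)"
  by (simp add: interior_polygon_def interior_lattice_points)

section \<open>Unimodular maps of the plane and of integer pairs\<close>

lemma unimodular_imp_umap:
  assumes "unimodular \<phi>"
  obtains \<psi> where "umap \<psi>" "\<And>p. \<phi> (emb p) = emb (\<psi> p)"
proof -
  obtain A :: "int^2^2" and w where inv: "invertible A" and w: "w \<in> lattice_points"
    and phi: "\<phi> = (\<lambda>v. map_matrix real_of_int A *v v + w)"
    using assms unfolding unimodular_def by blast
  obtain B where "A ** B = mat 1" using inv unfolding invertible_def by blast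
  then have "det A * det B = 1" by (metis det_I det_mul)
  then have "\<bar>det A\<bar> = 1" by (metis dvd_triv_left zdvd1_eq)
  then have d: "\<bar>A$1$1 * A$2$2 - A$1$2 * A$2$1\<bar> = 1" by (simp add: det_2)
  obtain q where q: "w = emb q" using w by (rule lattice_pointsE)
  show thesis
  proof (rule that[OF umapI[OF d, of "fst q" "snd q"]])
    show "\<phi> (emb p) = emb (A$1$1 * fst p + A$1$2 * snd p + fst q, A$2$1 * fst p + A$2$2 * snd p + snd q)" for p
      by (simp add: phi q vec_eq_iff forall_2 matrix_vector_mult_def sum_2 map_matrix_def)
  qed
qed

lemma umap_imp_unimodular:
  assumes "umap \<psi>"
  obtains \<phi> where "unimodular \<phi>" "\<And>p. \<phi> (emb p) = emb (\<psi> p)"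
proof -
  obtain a b c d e f where 1: "\<bar>a * d - b * c\<bar> = 1"
    and psi: "\<psi> = (\<lambda>p. (a * fst p + b * snd p + e, c * fst p + d * snd p + f))"
    using assms unfolding umap_def by blast
  define D where "D = a * d - b * c"
  have D: "D * D = 1" using 1 unfolding D_def by (metis abs_mult_self_eq mult_1)
  define A :: "int^2^2" where "A = vector [vector [a, b], vector [c, d]]"
  define B :: "int^2^2" where "B = vector [vector [D * d, - D * b], vector [- D * c, D * a]]"
  have *: "a * (D * d) - b * (D * c) = D * D" "d * (D * a) - c * (D * b) = D * D" by (simp_all add: D_def algebra_simps)
  have "A ** B = mat 1" "B ** A = mat 1"
    using * D by (simp_all add: vec_eq_iff forall_2 matrix_matrix_mult_def sum_2 A_def B_def mat_def algebra_simps)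
  then have "invertible A" unfolding invertible_def by blast
  then have u: "unimodular (\<lambda>v. map_matrix real_of_int A *v v + emb (e, f))"
    unfolding unimodular_def using emb_in_lattice by blast
  show thesis
    by (rule that[OF u]) (simp add: psi vec_eq_iff forall_2 matrix_vector_mult_def sum_2 map_matrix_def A_def)
qed

lemma unimodular_hull_image:
  assumes "unimodular \<phi>"
  shows "\<phi> ` (convex hull X) = convex hull (\<phi> ` X)"
proof -
  obtain M w where phi: "\<phi> = (\<lambda>v. M *v v + w)"
    using assms unfolding unimodular_def by blast
  have e: "\<phi> ` Y = (\<lambda>v. w + v) ` (\<lambda>v. M *v v) ` Y" for Y
    unfolding phi image_image by (simp add: add.commute)
  show ?thesis unfolding e convex_hull_translation
    by (simp add: convex_hull_linear_image matrix_vector_mul_linear)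
qed

lemma scaled_unit_square:
  assumes "0 \<le> d"
  shows "(\<lambda>v. d *\<^sub>R v) ` unit_square = {v. \<forall>i. 0 \<le> v $ i \<and> v $ i \<le> d}"
proof
  show "(\<lambda>v. d *\<^sub>R v) ` unit_square \<subseteq> {v. \<forall>i. 0 \<le> v $ i \<and> v $ i \<le> d}"
    using assms by (auto simp: unit_square_def mult_left_le)
  show "{v. \<forall>i. 0 \<le> v $ i \<and> v $ i \<le> d} \<subseteq> (\<lambda>v. d *\<^sub>R v) ` unit_square"
  proof
    fix v :: "real^2" assume v: "v \<in> {v. \<forall>i. 0 \<le> v $ i \<and> v $ i \<le> d}"
    show "v \<in> (\<lambda>v. d *\<^sub>R v) ` unit_square"
    proof (cases "d = 0")
      case True
      then have "v = d *\<^sub>R 0" using v by (auto simp: vec_eq_iff intro: antisym)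
      moreover have "(0::real^2) \<in> unit_square" by (simp add: unit_square_def)
      ultimately show ?thesis by blast
    next
      case False
      then have "v = d *\<^sub>R ((1 / d) *\<^sub>R v)" by simp
      moreover have "(1 / d) *\<^sub>R v \<in> unit_square"
        using v False assms by (auto simp: unit_square_def field_simps)
      ultimately show ?thesis by blast
    qed
  qed
qed

lemma convex_coordinate_box: "convex {v :: real^2. \<forall>i. a \<le> v $ i \<and> v $ i \<le> b}"
proof -
  have "{v :: real^2. \<forall>i. a \<le> v $ i \<and> v $ i \<le> b} = cbox (vec a) (vec b)"
    by (auto simp: mem_box_cart)
  then show ?thesis by (simp add: convex_box)
qed

text \<open>The scaled square is convex, so containment is tested on the generators, where the real
  map and its integer counterpart agree. Both minima thus range over the same condition.\<close>

lemma ls_square_hull: "ls_square (convex hull (emb ` S)) = lattice_size S"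
proof -
  have "(\<exists>\<phi>. unimodular \<phi> \<and> \<phi> ` (convex hull (emb ` S)) \<subseteq> (\<lambda>v. real d *\<^sub>R v) ` unit_square) \<longleftrightarrow> fits_square (int d) S" for d
  proof -
    have key: "\<phi> ` (convex hull (emb ` S)) \<subseteq> (\<lambda>v. real d *\<^sub>R v) ` unit_square \<longleftrightarrow>
        (\<forall>p\<in>S. 0 \<le> fst (\<psi> p) \<and> fst (\<psi> p) \<le> int d \<and> 0 \<le> snd (\<psi> p) \<and> snd (\<psi> p) \<le> int d)"
      if u: "unimodular \<phi>" and e: "\<And>p. \<phi> (emb p) = emb (\<psi> p)" for \<phi> \<psi>
    proof -
      have "\<phi> ` (convex hull (emb ` S)) \<subseteq> (\<lambda>v. real d *\<^sub>R v) ` unit_square \<longleftrightarrow>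
          \<phi> ` emb ` S \<subseteq> {v. \<forall>i. 0 \<le> v $ i \<and> v $ i \<le> real d}"
        unfolding unimodular_hull_image[OF u] scaled_unit_square[OF of_nat_0_le_iff]
        by (rule subset_hull) (rule convex_coordinate_box)
      also have "\<dots> \<longleftrightarrow> (\<forall>p\<in>S. 0 \<le> fst (\<psi> p) \<and> fst (\<psi> p) \<le> int d \<and> 0 \<le> snd (\<psi> p) \<and> snd (\<psi> p) \<le> int d)"
      proof -
        have "real_of_int x \<le> real d \<longleftrightarrow> x \<le> int d" for x by linarith
        then show ?thesis by (simp add: image_subset_iff e forall_2)
      qed
      finally show ?thesis .
    qed
    show ?thesis
    proof
      assume "\<exists>\<phi>. unimodular \<phi> \<and> \<phi> ` (convex hull (emb ` S)) \<subseteq> (\<lambda>v. real d *\<^sub>R v) ` unit_square"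
      then obtain \<phi> where f: "unimodular \<phi>" "\<phi> ` (convex hull (emb ` S)) \<subseteq> (\<lambda>v. real d *\<^sub>R v) ` unit_square" by blast
      obtain \<psi> where "umap \<psi>" "\<And>p. \<phi> (emb p) = emb (\<psi> p)" using unimodular_imp_umap[OF f(1)] by blast
      then show "fits_square (int d) S" unfolding fits_square_def using key[OF f(1)] f(2) by blast
    next
      assume "fits_square (int d) S"
      then obtain \<psi> where s: "umap \<psi>"
        "\<forall>p\<in>S. 0 \<le> fst (\<psi> p) \<and> fst (\<psi> p) \<le> int d \<and> 0 \<le> snd (\<psi> p) \<and> snd (\<psi> p) \<le> int d"
        unfolding fits_square_def by blast
      obtain \<phi> where "unimodular \<phi>" "\<And>p. \<phi> (emb p) = emb (\<psi> p)" using umap_imp_unimodular[OF s(1)] by blast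
      then show "\<exists>\<phi>. unimodular \<phi> \<and> \<phi> ` (convex hull (emb ` S)) \<subseteq> (\<lambda>v. real d *\<^sub>R v) ` unit_square"
        using key s(2) by blast
    qed
  qed
  then show ?thesis by (simp add: ls_square_def lattice_size_def)
qed

section \<open>Lattice size of finite integer sets\<close>

lemma lattice_size_eqI:
  assumes "S \<noteq> {}" "0 \<le> n" "fits_square n S" "\<And>d. 0 \<le> d \<Longrightarrow> d < n \<Longrightarrow> \<not> fits_square d S"
  shows "lattice_size S = n"
proof -
  have "(LEAST d::nat. fits_square (int d) S) = nat n"
  proof (rule Least_equality)
    show "fits_square (int (nat n)) S" using assms by simp
    show "nat n \<le> d" if "fits_square (int d) S" for d
      using assms(2) assms(4)[of "int d"] that by (cases "int d < n") auto
  qed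
  then show ?thesis using assms by (simp add: lattice_size_def)
qed

lemma lattice_size_image: "umap \<psi> \<Longrightarrow> lattice_size (\<psi> ` S) = lattice_size S"
  by (simp add: lattice_size_def fits_square_image)

lemma fits_square_lattice_size:
  assumes "finite S" "S \<noteq> {}"
  shows "0 \<le> lattice_size S" "fits_square (lattice_size S) S"
proof -
  obtain B where B: "\<And>z. z \<in> (fst ` S \<union> snd ` S) \<Longrightarrow> z \<le> B"
    by (meson assms(1) bdd_above_finite bdd_above.E finite_UnI finite_imageI)
  obtain C where C: "\<And>z. z \<in> (fst ` S \<union> snd ` S) \<Longrightarrow> C \<le> z"
    by (meson assms(1) bdd_below_finite bdd_below.E finite_UnI finite_imageI)
  have "fits_square (int (nat (B - C))) S"
  proof (rule fits_square_widths[OF assms(1)])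
    fix p q assume "p \<in> S" "q \<in> S"
    then have "fst p \<le> B" "snd p \<le> B" "C \<le> fst q" "C \<le> snd q" using B C by blast+
    then show "fst p - fst q \<le> int (nat (B - C)) \<and> snd p - snd q \<le> int (nat (B - C))" by linarith
  qed simp
  then have "fits_square (int (LEAST d::nat. fits_square (int d) S)) S" by (rule LeastI)
  then show "fits_square (lattice_size S) S" using assms by (simp add: lattice_size_def)
  show "0 \<le> lattice_size S" using assms by (simp add: lattice_size_def)
qed

lemma lattice_size_le:
  assumes "0 \<le> d" "fits_square d S"
  shows "lattice_size S \<le> d"
  using assms Least_le[of "\<lambda>d. fits_square (int d) S" "nat d"] by (auto simp: lattice_size_def)

lemma unimod_equiv_hull_iff:
  "convex hull (emb ` S) unimod_equiv convex hull (emb ` T) \<longleftrightarrow>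
    (\<exists>\<psi>. umap \<psi> \<and> convex hull (emb ` \<psi> ` S) = convex hull (emb ` T))"
proof -
  have key: "\<phi> ` (convex hull (emb ` S)) = convex hull (emb ` \<psi> ` S)"
    if "unimodular \<phi>" "\<And>p. \<phi> (emb p) = emb (\<psi> p)" for \<phi> \<psi>
    unfolding unimodular_hull_image[OF that(1)] by (simp add: image_image that(2))
  show ?thesis
  proof
    assume "convex hull (emb ` S) unimod_equiv convex hull (emb ` T)"
    then obtain \<phi> where f: "unimodular \<phi>" "convex hull (emb ` T) = \<phi> ` (convex hull (emb ` S))"
      unfolding unimod_equiv_def by blast
    obtain \<psi> where s: "umap \<psi>" "\<And>p. \<phi> (emb p) = emb (\<psi> p)" using unimodular_imp_umap[OF f(1)] by blast
    then show "\<exists>\<psi>. umap \<psi> \<and> convex hull (emb ` \<psi> ` S) = convex hull (emb ` T)"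
      using key[OF f(1) s(2)] f(2) by blast
  next
    assume "\<exists>\<psi>. umap \<psi> \<and> convex hull (emb ` \<psi> ` S) = convex hull (emb ` T)"
    then obtain \<psi> where s: "umap \<psi>" "convex hull (emb ` \<psi> ` S) = convex hull (emb ` T)" by blast
    obtain \<phi> where f: "unimodular \<phi>" "\<And>p. \<phi> (emb p) = emb (\<psi> p)" using umap_imp_unimodular[OF s(1)] by blast
    then show "convex hull (emb ` S) unimod_equiv convex hull (emb ` T)"
      unfolding unimod_equiv_def using key[OF f] s(2) by (intro exI[of _ \<phi>]) simp
  qed
qed

lemma unimod_equiv_values:
  assumes "aff_dim (convex hull (emb ` S)) = 2"
    "convex hull (emb ` S) unimod_equiv convex hull (emb ` T)"
  shows "ls_square (convex hull (emb ` S)) = lattice_size T"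
    "ls_square (interior_polygon (convex hull (emb ` S))) = lattice_size (inner_points T)"
proof -
  obtain \<psi> where u: "umap \<psi>" and e: "convex hull (emb ` \<psi> ` S) = convex hull (emb ` T)"
    using assms(2) unfolding unimod_equiv_hull_iff by blast
  show "ls_square (convex hull (emb ` S)) = lattice_size T"
    by (metis e ls_square_hull lattice_size_image u)
  show "ls_square (interior_polygon (convex hull (emb ` S))) = lattice_size (inner_points T)"
    using inner_points_hull_cong[OF e] inner_points_image[OF u, of S] lattice_size_image[OF u, of "inner_points S"]
    by (simp add: interior_polygon_hull[OF assms(1)] ls_square_hull)
qed

subsection \<open>Lattice strips and long edges\<close>

definition shape1 :: "int \<Rightarrow> int \<Rightarrow> (int \<times> int) set \<Rightarrow> bool" where
  "shape1 a b S \<longleftrightarrow> 0 \<le> b \<and> b \<le> a \<and> {(0, 0), (a, 0), (0, 1), (b, 1)} \<subseteq> S \<and>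
     (\<forall>p\<in>S. 0 \<le> fst p \<and> (snd p = 0 \<and> fst p \<le> a \<or> snd p = 1 \<and> fst p \<le> b))"

lemma row_extremes:
  fixes T :: "(int \<times> int) set"
  assumes "finite T" "p \<in> T" "snd p = y"
  obtains l r where "(l, y) \<in> T" "(r, y) \<in> T" "l \<le> r" "\<And>x. (x, y) \<in> T \<Longrightarrow> l \<le> x \<and> x \<le> r"
proof -
  define R where "R = {q \<in> T. snd q = y}"
  have "p \<in> R" using assms by (simp add: R_def)
  then have "R \<noteq> {}" by blast
  moreover have "finite R" using assms(1) by (simp add: R_def)
  ultimately have R: "finite R" "R \<noteq> {}" by simp_all
  obtain L where L: "L \<in> R" "\<And>q. q \<in> R \<Longrightarrow> fst L \<le> fst q" using ex_minimizer[OF R, of fst] by blast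
  obtain M where M: "M \<in> R" "\<And>q. q \<in> R \<Longrightarrow> - fst M \<le> - fst q" using ex_minimizer[OF R, of "\<lambda>q. - fst q"] by blast
  have m: "(fst L, y) \<in> T" "(fst M, y) \<in> T" using L(1) M(1) unfolding R_def by (metis (mono_tags, lifting) mem_Collect_eq prod.collapse)+
  have b: "fst L \<le> x \<and> x \<le> fst M" if "(x, y) \<in> T" for x
    using L(2)[of "(x, y)"] M(2)[of "(x, y)"] that by (simp add: R_def)
  show thesis by (rule that[OF m _ b]) (use b[OF m(1)] in auto)
qed

text \<open>A shear slides the two rows against each other, so both can start at 0; the longer row
  goes to the bottom, with a flip if necessary.\<close>

lemma strip_normal_form:
  assumes fin: "finite S" and nc: "\<not> collinear_pts S" and st: "strip S"
  obtains \<psi> a b where "umap \<psi>" "shape1 a b (\<psi> ` S)"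
proof -
  obtain \<psi> where u: "umap \<psi>" and s: "\<And>p. p \<in> S \<Longrightarrow> 0 \<le> snd (\<psi> p) \<and> snd (\<psi> p) \<le> 1"
    using st unfolding strip_def by blast
  define T where "T = \<psi> ` S"
  have finT: "finite T" using fin by (simp add: T_def)
  have ncT: "\<not> collinear_pts T" using collinear_pts_image[OF u] nc T_def by blast
  have sT: "snd p = 0 \<or> snd p = 1" if p: "p \<in> T" for p
  proof -
    obtain q where "q \<in> S" "p = \<psi> q" using p by (auto simp: T_def)
    then show ?thesis using s[of q] by auto
  qed
  have row: "\<exists>p\<in>T. snd p = y" if "y = 0 \<or> y = 1" for y
  proof (rule ccontr)
    assume "\<not> ?thesis"
    then have "\<forall>p\<in>T. 0 * fst p + 1 * snd p = 1 - y" using sT that by force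
    then show False using ncT unfolding collinear_pts_def by (metis zero_neq_one)
  qed
  obtain p0 p1 where p: "p0 \<in> T" "snd p0 = 0" "p1 \<in> T" "snd p1 = 1" using row[of 0] row[of 1] by auto
  obtain l0 r0 where 0: "(l0, 0) \<in> T" "(r0, 0) \<in> T" "l0 \<le> r0" "\<And>x. (x, 0) \<in> T \<Longrightarrow> l0 \<le> x \<and> x \<le> r0"
    using row_extremes[OF finT p(1,2)] by blast
  obtain l1 r1 where 1: "(l1, 1) \<in> T" "(r1, 1) \<in> T" "l1 \<le> r1" "\<And>x. (x, 1) \<in> T \<Longrightarrow> l1 \<le> x \<and> x \<le> r1"
    using row_extremes[OF finT p(3,4)] by blast
  have pT: "snd p = 0 \<and> l0 \<le> fst p \<and> fst p \<le> r0 \<or> snd p = 1 \<and> l1 \<le> fst p \<and> fst p \<le> r1" if "p \<in> T" for p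
    using sT[OF that] 0(4)[of "fst p"] 1(4)[of "fst p"] that by (cases p) auto
  show thesis
  proof (cases "r1 - l1 \<le> r0 - l0")
    case True
    define \<tau> where "\<tau> = (\<lambda>p::int \<times> int. (1 * fst p + (l0 - l1) * snd p + (- l0), 0 * fst p + 1 * snd p + 0))"
    have t: "umap \<tau>" unfolding \<tau>_def by (rule umapI) simp
    have e: "\<tau> (l0, 0) = (0, 0)" "\<tau> (r0, 0) = (r0 - l0, 0)" "\<tau> (l1, 1) = (0, 1)" "\<tau> (r1, 1) = (r1 - l1, 1)"
      by (simp_all add: \<tau>_def)
    have "{(0, 0), (r0 - l0, 0), (0, 1), (r1 - l1, 1)} \<subseteq> \<tau> ` T"
      using 0(1,2) 1(1,2) e by (metis bot_least image_eqI insert_subset)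
    moreover have "0 \<le> fst (\<tau> p) \<and> (snd (\<tau> p) = 0 \<and> fst (\<tau> p) \<le> r0 - l0 \<or> snd (\<tau> p) = 1 \<and> fst (\<tau> p) \<le> r1 - l1)"
      if "p \<in> T" for p
      using pT[OF that] by (auto simp: \<tau>_def)
    ultimately have "shape1 (r0 - l0) (r1 - l1) (\<tau> ` T)"
      unfolding shape1_def using True 1(3) by auto
    then show thesis using that[OF umap_comp[OF t u]] by (simp add: T_def image_comp)
  next
    case False
    define \<tau> where "\<tau> = (\<lambda>p::int \<times> int. (1 * fst p + (l0 - l1) * snd p + (- l0), 0 * fst p + (-1) * snd p + 1))"
    have t: "umap \<tau>" unfolding \<tau>_def by (rule umapI) simp
    have e: "\<tau> (l0, 0) = (0, 1)" "\<tau> (r0, 0) = (r0 - l0, 1)" "\<tau> (l1, 1) = (0, 0)" "\<tau> (r1, 1) = (r1 - l1, 0)"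
      by (simp_all add: \<tau>_def)
    have "{(0, 0), (r1 - l1, 0), (0, 1), (r0 - l0, 1)} \<subseteq> \<tau> ` T"
      using 0(1,2) 1(1,2) e by (metis bot_least image_eqI insert_subset)
    moreover have "0 \<le> fst (\<tau> p) \<and> (snd (\<tau> p) = 0 \<and> fst (\<tau> p) \<le> r1 - l1 \<or> snd (\<tau> p) = 1 \<and> fst (\<tau> p) \<le> r0 - l0)"
      if "p \<in> T" for p
      using pT[OF that] by (auto simp: \<tau>_def)
    ultimately have "shape1 (r1 - l1) (r0 - l0) (\<tau> ` T)"
      unfolding shape1_def using False 0(3) by auto
    then show thesis using that[OF umap_comp[OF t u]] by (simp add: T_def image_comp)
  qed
qed

text \<open>The gap of 3 is used here: since n >= m + 3, the supporting line at (m + 2, 1) recedes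
  by at least one unit per row. Hence x + y <= m + 3 <= n above the base, and strictness leaves
  interior points with x, y >= 1 and x + y <= m + 2, a triangle of size m.\<close>

lemma long_edge_fits_normalised:
  assumes ends: "(0, 0) \<in> T" "(n, 0) \<in> T" and up: "\<And>p. p \<in> T \<Longrightarrow> 0 \<le> snd p"
    and row: "\<And>x. (x, 0) \<in> T \<Longrightarrow> 0 \<le> x \<and> x \<le> n"
    and I: "(1, 1) \<in> inner_points T" "(m + 1, 1) \<in> inner_points T"
    and nI: "(0, 1) \<notin> inner_points T" "(m + 2, 1) \<notin> inner_points T"
    and n: "0 \<le> m" "m + 3 \<le> n"
  shows "fits_square n T" "fits_square m (inner_points T)"
proof -
  obtain \<alpha> \<beta> where nz: "\<alpha> \<noteq> 0 \<or> \<beta> \<noteq> 0" and ge: "\<And>q. q \<in> T \<Longrightarrow> \<beta> \<le> lin \<alpha> \<beta> q"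
    using nI(1) by (elim not_inner_pointsE) simp
  obtain \<alpha>' \<beta>' where nz': "\<alpha>' \<noteq> 0 \<or> \<beta>' \<noteq> 0" and ge': "\<And>q. q \<in> T \<Longrightarrow> \<alpha>' * (real_of_int m + 2) + \<beta>' \<le> lin \<alpha>' \<beta>' q"
    using nI(2) by (elim not_inner_pointsE) simp
  have a: "0 < \<alpha>" using inner_pointsD[OF I(1) nz ge] by simp
  have b: "\<beta> \<le> 0" using ge[OF ends(1)] by simp
  have a': "\<alpha>' < 0" using inner_pointsD[OF I(2) nz' ge'] by (simp add: algebra_simps)
  have "\<beta>' \<le> \<alpha>' * (real_of_int n - m - 2)" using ge'[OF ends(2)] by (simp add: algebra_simps)
  also have "\<dots> \<le> \<alpha>' * 1" using a' n(2) by (intro mult_left_mono_neg) auto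
  finally have b': "\<beta>' \<le> \<alpha>'" by simp
  have x0: "0 \<le> x" if p: "(x, y) \<in> T" for x y
  proof (cases "y = 0")
    case False
    then have "\<beta> * (real_of_int y - 1) \<le> 0" using up[OF p] b by (simp add: mult_le_0_iff)
    then have "0 \<le> \<alpha> * x" using ge[OF p] by (simp add: algebra_simps)
    then show ?thesis using a by (simp add: zero_le_mult_iff)
  qed (use row p in blast)
  have s: "\<alpha>' * (real_of_int (x + y) - (m + 3)) \<ge> lin \<alpha>' \<beta>' (x, y) - (\<alpha>' * (real_of_int m + 2) + \<beta>')"
    if "1 \<le> y" for x y
  proof -
    have "\<beta>' * (real_of_int y - 1) \<le> \<alpha>' * (real_of_int y - 1)" using b' that by (intro mult_right_mono) auto
    then show ?thesis by (simp add: algebra_simps)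
  qed
  have xy: "x + y \<le> n" if p: "(x, y) \<in> T" for x y
  proof (cases "y = 0")
    case False
    then have "0 \<le> \<alpha>' * (real_of_int (x + y) - (m + 3))" using s[of y x] ge'[OF p] up[OF p] by simp
    then have "real_of_int (x + y) \<le> m + 3" using a' by (simp add: zero_le_mult_iff)
    then show ?thesis using n(2) by linarith
  qed (use row p in auto)
  show "fits_square n T"
  proof (rule fits_squareI[OF umap_id])
    fix p assume "p \<in> T"
    then show "0 \<le> fst p \<and> fst p \<le> n \<and> 0 \<le> snd p \<and> snd p \<le> n"
      using x0[of "fst p" "snd p"] xy[of "fst p" "snd p"] up[of p] by simp
  qed
  have t: "umap (\<lambda>p. (1 * fst p + 0 * snd p + (- 1), 0 * fst p + 1 * snd p + (- 1)))"
    by (rule umapI) simp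
  show "fits_square m (inner_points T)"
  proof (rule fits_squareI[OF t])
    fix p assume p: "p \<in> inner_points T"
    have 1: "0 < 1 * fst p + 0 * snd p"
      by (rule inner_pointsD_int[OF p]) (use x0 in auto)
    have 2: "0 < 0 * fst p + 1 * snd p"
      by (rule inner_pointsD_int[OF p]) (use up in auto)
    have "\<alpha>' * (real_of_int m + 2) + \<beta>' < lin \<alpha>' \<beta>' (fst p, snd p)" using inner_pointsD[OF p nz' ge'] by simp
    then have "0 < \<alpha>' * (real_of_int (fst p + snd p) - (m + 3))" using s[of "snd p" "fst p"] 2 by simp
    then have "real_of_int (fst p + snd p) < m + 3" using a' by (simp add: zero_less_mult_iff)
    then show "0 \<le> fst (1 * fst p + 0 * snd p + - 1, 0 * fst p + 1 * snd p + - 1) \<and>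
        fst (1 * fst p + 0 * snd p + - 1, 0 * fst p + 1 * snd p + - 1) \<le> m \<and>
        0 \<le> snd (1 * fst p + 0 * snd p + - 1, 0 * fst p + 1 * snd p + - 1) \<and>
        snd (1 * fst p + 0 * snd p + - 1, 0 * fst p + 1 * snd p + - 1) \<le> m"
      using 1 2 by simp
  qed
qed

text \<open>By a shear, the bottom row can start at 0 and the interior row at 1. The two rows
  themselves are segments that forbid smaller squares.\<close>

lemma long_edge_lattice_sizes:
  assumes ends: "(l, 0) \<in> T" "(r, 0) \<in> T" and up: "\<And>p. p \<in> T \<Longrightarrow> 0 \<le> snd p"
    and row: "\<And>x. (x, 0) \<in> T \<Longrightarrow> l \<le> x \<and> x \<le> r"
    and I: "(i, 1) \<in> inner_points T" "(j, 1) \<in> inner_points T" "i \<le> j"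
    and rowI: "\<And>x. (x, 1) \<in> inner_points T \<Longrightarrow> i \<le> x \<and> x \<le> j"
    and n: "j - i + 3 \<le> r - l"
  shows "lattice_size T = r - l" "lattice_size (inner_points T) = j - i"
proof -
  define \<tau> where "\<tau> = (\<lambda>p::int \<times> int. (1 * fst p + (l + 1 - i) * snd p + (- l), 0 * fst p + 1 * snd p + 0))"
  have t: "umap \<tau>" unfolding \<tau>_def by (rule umapI) simp
  have mem: "(x, y) \<in> \<tau> ` X \<longleftrightarrow> (x + l - (l + 1 - i) * y, y) \<in> X" for x y X
  proof -
    have "(x, y) = \<tau> q \<longleftrightarrow> q = (x + l - (l + 1 - i) * y, y)" for q by (cases q) (auto simp: \<tau>_def)
    then show ?thesis by (metis image_iff)
  qed
  note it = inner_points_image[OF t, of T]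
  have 1: "(0, 0) \<in> \<tau> ` T" "(r - l, 0) \<in> \<tau> ` T" using ends by (simp_all add: mem)
  have 2: "0 \<le> snd p" if "p \<in> \<tau> ` T" for p using that up by (auto simp: \<tau>_def)
  have 3: "0 \<le> x \<and> x \<le> r - l" if "(x, 0) \<in> \<tau> ` T" for x
    using row[of "x + l"] that by (simp add: mem)
  have 4: "(1, 1) \<in> inner_points (\<tau> ` T)" "(j - i + 1, 1) \<in> inner_points (\<tau> ` T)"
    using I by (simp_all add: mem it)
  have 5: "(0, 1) \<notin> inner_points (\<tau> ` T)" "(j - i + 2, 1) \<notin> inner_points (\<tau> ` T)"
    using rowI[of "i - 1"] rowI[of "j + 1"] by (auto simp: mem it)
  have f: "fits_square (r - l) (\<tau> ` T)" "fits_square (j - i) (inner_points (\<tau> ` T))"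
    using long_edge_fits_normalised[OF 1 2 3 4 5] I(3) n by simp_all
  show "lattice_size T = r - l"
    by (rule lattice_size_eqI) (use ends n I(3) f(1) fits_square_image[OF t] not_fits_segment[OF ends, of "r - l"] in auto)
  show "lattice_size (inner_points T) = j - i"
    by (rule lattice_size_eqI) (use I f(2) fits_square_image[OF t] it not_fits_segment[OF I(1,2), of "j - i"] in auto)
qed

subsection \<open>Situations 1 to 4\<close>

text \<open>s and t are the barycentric weights of A and B, and the origin is the third vertex. A
  and B may coincide, which covers segments.\<close>

lemma emb_in_hull_triangle:
  fixes s t :: real
  assumes "(0, 0) \<in> V" "A \<in> V" "B \<in> V" "0 \<le> s" "0 \<le> t" "s + t \<le> 1"
    "of_int (fst p) = s * of_int (fst A) + t * of_int (fst B)"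
    "of_int (snd p) = s * of_int (snd A) + t * of_int (snd B)"
  shows "emb p \<in> convex hull (emb ` V)"
proof -
  have e: "emb p = (1 - s - t) *\<^sub>R emb (0, 0) + s *\<^sub>R emb A + t *\<^sub>R emb B"
    using assms(7,8) by (simp add: vec_eq_iff forall_2)
  have "emb p \<in> convex hull {emb (0, 0), emb A, emb B}"
    unfolding convex_hull_3 mem_Collect_eq
    by (rule exI[of _ "1 - s - t"], rule exI[of _ s], rule exI[of _ t]) (use assms(4-6) e in simp)
  also have "\<dots> \<subseteq> convex hull (emb ` V)" by (rule hull_mono) (use assms(1-3) in auto)
  finally show ?thesis .
qed

lemma hull_emb_eqI:
  assumes "V \<subseteq> S" "\<And>p. p \<in> S \<Longrightarrow> emb p \<in> convex hull (emb ` V)"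
  shows "convex hull (emb ` S) = convex hull (emb ` V)"
proof
  show "convex hull (emb ` S) \<subseteq> convex hull (emb ` V)"
    by (rule hull_minimal) (use assms(2) in auto)
  show "convex hull (emb ` V) \<subseteq> convex hull (emb ` S)"
    by (rule hull_mono) (use assms(1) in auto)
qed

lemma emb_numerals:
  "vector [0, 0] = emb (0, 0)" "vector [of_int a, 0] = emb (a, 0)" "vector [0, 1] = emb (0, 1)"
  "vector [of_int a, 1] = emb (a, 1)" "vector [numeral k, 0] = emb (numeral k, 0)"
  "vector [0, numeral k] = emb (0, numeral k)" "vector [numeral k, 1] = emb (numeral k, 1)"
  "vector [1, numeral k] = emb (1, numeral k)"
  by (simp_all add: emb_def)

lemma situation_emb:
  "situation1 P a b \<longleftrightarrow> a \<ge> 2 \<and> a \<ge> b \<and> b \<ge> 0 \<and>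
     P unimod_equiv convex hull (emb ` {(0, 0), (a, 0), (0, 1), (b, 1)})"
  "situation2 P \<longleftrightarrow> P unimod_equiv convex hull (emb ` {(0, 0), (2, 0), (0, 2)})"
  "situation3 P \<longleftrightarrow>
     P unimod_equiv convex hull (emb ` {(0, 0), (3, 0), (0, 3)}) \<or>
     P unimod_equiv convex hull (emb ` {(0, 0), (3, 0), (0, 2)}) \<or>
     P unimod_equiv convex hull (emb ` {(0, 0), (3, 0), (2, 1), (0, 2)}) \<or>
     P unimod_equiv convex hull (emb ` {(0, 0), (3, 0), (1, 2), (0, 2)})"
  "situation4 P \<longleftrightarrow> P unimod_equiv convex hull (emb ` {(0, 0), (4, 0), (0, 2)})"
  by (simp_all only: situation1_def situation2_def situation3_def situation4_def emb_numerals image_insert image_empty)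

lemma shape_equiv:
  assumes "umap \<psi>" "V \<subseteq> \<psi> ` S" "\<And>p. p \<in> \<psi> ` S \<Longrightarrow> emb p \<in> convex hull (emb ` V)"
  shows "convex hull (emb ` S) unimod_equiv convex hull (emb ` V)"
  unfolding unimod_equiv_hull_iff using assms(1) hull_emb_eqI[OF assms(2,3)] by blast

lemma situation2_if_shape2:
  assumes "umap \<psi>" "shape2 (\<psi> ` S)"
  shows "situation2 (convex hull (emb ` S))"
  unfolding situation_emb
proof (rule shape_equiv[OF assms(1)])
  show "{(0, 0), (2, 0), (0, 2)} \<subseteq> \<psi> ` S" using assms(2) by (simp add: shape2_def)
  fix p assume "p \<in> \<psi> ` S"
  then have "0 \<le> fst p" "0 \<le> snd p" "fst p + snd p \<le> 2" using assms(2) by (auto simp: shape2_def)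
  then show "emb p \<in> convex hull (emb ` {(0, 0), (2, 0), (0, 2)})"
    by (intro emb_in_hull_triangle[of _ "(2, 0)" "(0, 2)" "fst p / 2" "snd p / 2"]) auto
qed

lemma situation4_if_shape4:
  assumes "umap \<psi>" "shape4 (\<psi> ` S)"
  shows "situation4 (convex hull (emb ` S))"
  unfolding situation_emb
proof (rule shape_equiv[OF assms(1)])
  show "{(0, 0), (4, 0), (0, 2)} \<subseteq> \<psi> ` S" using assms(2) by (simp add: shape4_def)
  fix p assume "p \<in> \<psi> ` S"
  then have "0 \<le> fst p" "0 \<le> snd p" "fst p + 2 * snd p \<le> 4" using assms(2) by (auto simp: shape4_def)
  then show "emb p \<in> convex hull (emb ` {(0, 0), (4, 0), (0, 2)})"
    by (intro emb_in_hull_triangle[of _ "(4, 0)" "(0, 2)" "fst p / 4" "snd p / 2"]) auto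
qed

lemma situation1_if_shape1:
  assumes "umap \<psi>" "shape1 a b (\<psi> ` S)" "2 \<le> a"
  shows "situation1 (convex hull (emb ` S)) a b"
proof -
  have ab: "0 \<le> b" "b \<le> a" using assms(2) by (auto simp: shape1_def)
  let ?V = "{(0, 0), (a, 0), (0, 1), (b, 1)}"
  have "convex hull (emb ` S) unimod_equiv convex hull (emb ` ?V)"
  proof (rule shape_equiv[OF assms(1)])
    show "?V \<subseteq> \<psi> ` S" using assms(2) by (simp add: shape1_def)
    fix p assume "p \<in> \<psi> ` S"
    then have p: "0 \<le> fst p" "snd p = 0 \<and> fst p \<le> a \<or> snd p = 1 \<and> fst p \<le> b"
      using assms(2) by (auto simp: shape1_def)
    show "emb p \<in> convex hull (emb ` ?V)"
    proof (cases "snd p = 0")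
      case True
      then show ?thesis using p assms(3)
        by (intro emb_in_hull_triangle[of _ "(a, 0)" "(a, 0)" "fst p / a" 0]) auto
    next
      case False
      then have p': "snd p = 1" "fst p \<le> b" using p by auto
      show ?thesis
      \<comment> \<open>For b = 0 the top row is a single point and the weight
        \<open>fst p / b\<close> is meaningless.\<close>
      proof (cases "b = 0")
        case True
        then have "p = (0, 1)" using p p' by (simp add: prod_eq_iff)
        then show ?thesis by (simp add: hull_inc)
      next
        case False
        then show ?thesis using p p' ab
          by (intro emb_in_hull_triangle[of _ "(b, 1)" "(0, 1)" "fst p / b" "1 - fst p / b"]) auto
      qed
    qed
  qed
  then show ?thesis using ab assms(3) by (simp add: situation_emb)
qed

lemma situation3_if_shape3:
  assumes "umap \<psi>" "shape3 (\<psi> ` S)"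
  shows "situation3 (convex hull (emb ` S))"
proof -
  let ?T = "\<psi> ` S"
  have nn: "0 \<le> fst p" "0 \<le> snd p" if "p \<in> ?T" for p using assms(2) that by (auto simp: shape3_def)
  consider (a) "{(0, 0), (3, 0), (0, 3)} \<subseteq> ?T" "\<And>p. p \<in> ?T \<Longrightarrow> fst p + snd p \<le> 3"
    | (b) "{(0, 0), (3, 0), (0, 2)} \<subseteq> ?T" "\<And>p. p \<in> ?T \<Longrightarrow> 2 * fst p + 3 * snd p \<le> 6"
    | (c) "{(0, 0), (3, 0), (2, 1), (0, 2)} \<subseteq> ?T" "\<And>p. p \<in> ?T \<Longrightarrow> fst p + snd p \<le> 3 \<and> fst p + 2 * snd p \<le> 4"
    | (d) "{(0, 0), (3, 0), (1, 2), (0, 2)} \<subseteq> ?T" "\<And>p. p \<in> ?T \<Longrightarrow> fst p + snd p \<le> 3 \<and> snd p \<le> 2"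
    using assms(2) unfolding shape3_def by blast
  then show ?thesis
  proof cases
    case a
    have "emb p \<in> convex hull (emb ` {(0, 0), (3, 0), (0, 3)})" if "p \<in> ?T" for p
      using nn[OF that] a(2)[OF that]
      by (intro emb_in_hull_triangle[of _ "(3, 0)" "(0, 3)" "fst p / 3" "snd p / 3"]) auto
    from shape_equiv[OF assms(1) a(1) this] show ?thesis by (simp add: situation_emb)
  next
    case b
    have "emb p \<in> convex hull (emb ` {(0, 0), (3, 0), (0, 2)})" if "p \<in> ?T" for p
      using nn[OF that] b(2)[OF that]
      by (intro emb_in_hull_triangle[of _ "(3, 0)" "(0, 2)" "fst p / 3" "snd p / 2"]) auto
    from shape_equiv[OF assms(1) b(1) this] show ?thesis by (simp add: situation_emb)
  next
    case c
    have "emb p \<in> convex hull (emb ` {(0, 0), (3, 0), (2, 1), (0, 2)})" if "p \<in> ?T" for p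
    \<comment> \<open>The diagonal from the origin to (2, 1) splits the quadrilateral into two
      triangles.\<close>
    proof (cases "2 * snd p \<le> fst p")
      case True
      then show ?thesis using nn[OF that] c(2)[OF that]
        by (intro emb_in_hull_triangle[of _ "(3, 0)" "(2, 1)" "(fst p - 2 * snd p) / 3" "snd p"]) (auto simp: field_simps)
    next
      case False
      then show ?thesis using nn[OF that] c(2)[OF that]
        by (intro emb_in_hull_triangle[of _ "(2, 1)" "(0, 2)" "fst p / 2" "(2 * snd p - fst p) / 4"]) (auto simp: field_simps)
    qed
    from shape_equiv[OF assms(1) c(1) this] show ?thesis by (simp add: situation_emb)
  next
    case d
    have "emb p \<in> convex hull (emb ` {(0, 0), (3, 0), (1, 2), (0, 2)})" if "p \<in> ?T" for p
    \<comment> \<open>Here the diagonal runs from the origin to (1, 2).\<close>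
    proof (cases "snd p \<le> 2 * fst p")
      case True
      then show ?thesis using nn[OF that] d(2)[OF that]
        by (intro emb_in_hull_triangle[of _ "(3, 0)" "(1, 2)" "(2 * fst p - snd p) / 6" "snd p / 2"]) (auto simp: field_simps)
    next
      case False
      then show ?thesis using nn[OF that] d(2)[OF that]
        by (intro emb_in_hull_triangle[of _ "(1, 2)" "(0, 2)" "fst p" "(snd p - 2 * fst p) / 2"]) (auto simp: field_simps)
    qed
    from shape_equiv[OF assms(1) d(1) this] show ?thesis by (simp add: situation_emb)
  qed
qed

section \<open>Lattice sizes of the model polygons\<close>

lemma lattice_size_box:
  assumes "(0, 0) \<in> S" "(n, 0) \<in> S" "0 \<le> n" "\<And>p. p \<in> S \<Longrightarrow> 0 \<le> fst p \<and> fst p \<le> n \<and> 0 \<le> snd p \<and> snd p \<le> n"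
  shows "lattice_size S = n"
proof (rule lattice_size_eqI)
  show "fits_square n S" by (rule fits_squareI[OF umap_id assms(4)])
  show "\<not> fits_square d S" if "0 \<le> d" "d < n" for d
    by (rule not_fits_segment[OF assms(1,2), of n]) (use that in auto)
qed (use assms in auto)

lemma lattice_size_singleton: "lattice_size {p} = 0"
proof (rule lattice_size_eqI)
  show "fits_square 0 {p}" by (rule fits_square_widths) auto
qed auto

lemma inner_points_eq_point:
  fixes a b c :: int
  assumes nn: "\<And>q. q \<in> T \<Longrightarrow> 0 \<le> fst q \<and> 0 \<le> snd q"
    and ab: "0 < a" "\<And>q. q \<in> T \<Longrightarrow> a * fst q + b * snd q \<le> c"
    and xy: "\<And>x y. 1 \<le> x \<Longrightarrow> 1 \<le> y \<Longrightarrow> a * x + b * y < c \<Longrightarrow> x = 1 \<and> y = 1"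
    and T: "(0, 0) \<in> T" "(n, 0) \<in> T" "(0, h) \<in> T" "n = 3 \<or> n = 4" "h = 2 \<or> h = 3"
  shows "inner_points T = {(1, 1)}"
proof
  show "inner_points T \<subseteq> {(1, 1)}"
  proof
    fix p assume p: "p \<in> inner_points T"
    have "0 < 1 * fst p + 0 * snd p" by (rule inner_pointsD_int[OF p]) (use nn in auto)
    moreover have "0 < 0 * fst p + 1 * snd p" by (rule inner_pointsD_int[OF p]) (use nn in auto)
    moreover have "- c < (- a) * fst p + (- b) * snd p"
    proof (rule inner_pointsD_int[OF p])
      show "- c \<le> (- a) * fst q + (- b) * snd q" if "q \<in> T" for q using ab(2)[OF that] by simp
    qed (use ab(1) in simp)
    ultimately have "fst p = 1 \<and> snd p = 1" by (intro xy) auto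
    then show "p \<in> {(1, 1)}" by (simp add: prod_eq_iff)
  qed
  have "(1, 1) \<in> inner_points T"
  proof (rule ccontr)
    assume "(1, 1) \<notin> inner_points T"
    then obtain \<alpha> \<beta> where nz: "\<alpha> \<noteq> 0 \<or> \<beta> \<noteq> 0" and ge: "\<And>q. q \<in> T \<Longrightarrow> \<alpha> + \<beta> \<le> lin \<alpha> \<beta> q"
      by (elim not_inner_pointsE) simp
    \<comment> \<open>These exclude every nonzero form because 1/n + 1/h < 1, so that (1, 1) is
      interior to the triangle (0, 0), (n, 0), (0, h).\<close>
    have "\<alpha> + \<beta> \<le> 0" "\<alpha> + \<beta> \<le> \<alpha> * n" "\<alpha> + \<beta> \<le> \<beta> * h"
      using ge[OF T(1)] ge[OF T(2)] ge[OF T(3)] by simp_all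
    then have "\<alpha> = 0" "\<beta> = 0" using T(4,5) by auto
    then show False using nz by simp
  qed
  then show "{(1, 1)} \<subseteq> inner_points T" by simp
qed

text \<open>For each polygon one slanted edge a x + b y <= c suffices: strictly below it, (1, 1) is
  the only lattice point with positive coordinates. The numerals are a, b, c and the legs n, h of a
  right triangle inside the polygon.\<close>

lemma small_polygon_values:
  "inner_points {(0, 0), (3, 0), (0, 3)} = {(1, 1)}" "lattice_size {(0, 0), (3, 0), (0, 3)} = 3"
  "inner_points {(0, 0), (3, 0), (0, 2)} = {(1, 1)}" "lattice_size {(0, 0), (3, 0), (0, 2)} = 3"
  "inner_points {(0, 0), (3, 0), (2, 1), (0, 2)} = {(1, 1)}" "lattice_size {(0, 0), (3, 0), (2, 1), (0, 2)} = 3"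
  "inner_points {(0, 0), (3, 0), (1, 2), (0, 2)} = {(1, 1)}" "lattice_size {(0, 0), (3, 0), (1, 2), (0, 2)} = 3"
  "inner_points {(0, 0), (4, 0), (0, 2)} = {(1, 1)}" "lattice_size {(0, 0), (4, 0), (0, 2)} = 4"
  by ((rule inner_points_eq_point[of _ 1 1 3 3 3]; force) | (rule inner_points_eq_point[of _ 2 3 6 3 2]; force)
    | (rule inner_points_eq_point[of _ 1 2 4 3 2]; force) | (rule inner_points_eq_point[of _ 1 1 3 3 2]; force)
    | (rule inner_points_eq_point[of _ 1 2 4 4 2]; force) | (rule lattice_size_box; force))+

lemma inner_points_strip:
  assumes "\<And>q. q \<in> T \<Longrightarrow> 0 \<le> snd q \<and> snd q \<le> 1"
  shows "inner_points T = {}"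
proof -
  have False if p: "p \<in> inner_points T" for p
  proof -
    have "0 < 0 * fst p + 1 * snd p" by (rule inner_pointsD_int[OF p]) (use assms in auto)
    moreover have "-1 < 0 * fst p + (-1) * snd p" by (rule inner_pointsD_int[OF p]) (use assms in force)+
    ultimately show False by simp
  qed
  then show ?thesis by blast
qed

lemma inner_points_triangle2: "inner_points {(0, 0), (2, 0), (0, 2)} = {}"
proof -
  have False if p: "p \<in> inner_points {(0, 0), (2, 0), (0, 2)}" for p
  proof -
    have "0 < 1 * fst p + 0 * snd p" by (rule inner_pointsD_int[OF p]) auto
    moreover have "0 < 0 * fst p + 1 * snd p" by (rule inner_pointsD_int[OF p]) auto
    moreover have "-2 < (-1) * fst p + (-1) * snd p" by (rule inner_pointsD_int[OF p]) auto
    ultimately show False by simp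
  qed
  then show ?thesis by blast
qed

lemma situation_values:
  assumes S: "P = convex hull (emb ` S)" and dim: "aff_dim P = 2"
  shows "situation1 P a b \<Longrightarrow> ls_square (interior_polygon P) = -1 \<and> ls_square P = a"
    and "situation2 P \<Longrightarrow> ls_square (interior_polygon P) = -1 \<and> ls_square P = 2"
    and "situation3 P \<Longrightarrow> ls_square (interior_polygon P) = 0 \<and> ls_square P = 3"
    and "situation4 P \<Longrightarrow> ls_square (interior_polygon P) = 0 \<and> ls_square P = 4"
proof -
  note v = unimod_equiv_values[OF dim[unfolded S], folded S]
  have e: "lattice_size {} = -1" by (simp add: lattice_size_def)
  show "ls_square (interior_polygon P) = -1 \<and> ls_square P = a" if "situation1 P a b"
  proof -
    let ?T = "{(0, 0), (a, 0), (0, 1), (b, 1)}"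
    have s: "a \<ge> 2" "a \<ge> b" "b \<ge> 0" "P unimod_equiv convex hull (emb ` ?T)"
      using that by (auto simp: situation_emb)
    have "lattice_size ?T = a" by (rule lattice_size_box) (use s in auto)
    moreover have "inner_points ?T = {}" by (rule inner_points_strip) auto
    ultimately show ?thesis using v[OF s(4)] e by simp
  qed
  show "ls_square (interior_polygon P) = -1 \<and> ls_square P = 2" if "situation2 P"
  proof -
    have "lattice_size {(0, 0), (2, 0), (0, 2)} = 2" by (rule lattice_size_box) auto
    then show ?thesis using v[OF that[unfolded situation_emb]] e inner_points_triangle2 by simp
  qed
  show "ls_square (interior_polygon P) = 0 \<and> ls_square P = 3" if "situation3 P"
    using that v small_polygon_values lattice_size_singleton unfolding situation_emb by metis
  show "ls_square (interior_polygon P) = 0 \<and> ls_square P = 4" if "situation4 P"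
    using v[OF that[unfolded situation_emb]] small_polygon_values lattice_size_singleton by metis
qed

subsection \<open>Situation 5\<close>

text \<open>While \<open>inner_points\<close> and the lattice size depend only on the hull, counting
  points on edges requires S to contain all lattice points of its hull.\<close>

definition lattice_closed :: "(int \<times> int) set \<Rightarrow> bool" where
  "lattice_closed S \<longleftrightarrow> (\<forall>p. emb p \<in> convex hull (emb ` S) \<longrightarrow> p \<in> S)"

lemma lattice_closed_image:
  assumes u: "umap \<psi>" and S: "lattice_closed S"
  shows "lattice_closed (\<psi> ` S)"
  unfolding lattice_closed_def
proof (intro allI impI)
  fix p assume p: "emb p \<in> convex hull (emb ` \<psi> ` S)"
  obtain \<xi> where x: "umap \<xi>" "\<And>p. \<xi> (\<psi> p) = p" "\<And>p. \<psi> (\<xi> p) = p" using umap_inverse[OF u] by blast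
  obtain \<phi> where f: "unimodular \<phi>" "\<And>p. \<phi> (emb p) = emb (\<xi> p)" using umap_imp_unimodular[OF x(1)] by blast
  have "\<phi> (emb p) \<in> \<phi> ` (convex hull (emb ` \<psi> ` S))" using p by blast
  then have "emb (\<xi> p) \<in> convex hull (emb ` S)"
    unfolding unimodular_hull_image[OF f(1)] by (simp add: image_image f(2) x(2))
  then have "\<xi> p \<in> S" using S unfolding lattice_closed_def by blast
  then show "p \<in> \<psi> ` S" using x(3) by (metis image_eqI)
qed

text \<open>A lattice point that is not interior is cut off by an open half-plane containing all
  interior lattice points, hence their hull. Passing to the interior polygon therefore adds no
  lattice points.\<close>

lemma lattice_closed_inner_points: "lattice_closed (inner_points S)"
  unfolding lattice_closed_def
proof (intro allI impI, rule ccontr)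
  fix p assume p: "emb p \<in> convex hull (emb ` inner_points S)" and n: "p \<notin> inner_points S"
  obtain \<alpha> \<beta> where nz: "\<alpha> \<noteq> 0 \<or> \<beta> \<noteq> 0" and ge: "\<And>q. q \<in> S \<Longrightarrow> lin \<alpha> \<beta> p \<le> lin \<alpha> \<beta> q"
    using not_inner_pointsE[OF n] by blast
  have "convex hull (emb ` inner_points S) \<subseteq> {v. lin \<alpha> \<beta> p < lvec \<alpha> \<beta> \<bullet> v}"
    by (intro hull_minimal convex_halfspace_gt)
      (use inner_pointsD[OF _ nz ge] in \<open>auto simp: lin_eq_inner[symmetric]\<close>)
  then show False using p by (auto simp: lin_eq_inner)
qed

lemma lattice_closed_row:
  assumes "lattice_closed S" "(l, y) \<in> S" "(r, y) \<in> S" "l \<le> x" "x \<le> r"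
  shows "(x, y) \<in> S"
proof (cases "l = r")
  case True
  then show ?thesis using assms by simp
next
  case False
  define t where "t = (real_of_int x - l) / (real_of_int r - l)"
  have t: "0 \<le> t" "t \<le> 1" "t * (real_of_int r - l) = x - l" using assms(4,5) False by (auto simp: t_def)
  have "emb (x, y) = (1 - t) *\<^sub>R emb (l, y) + t *\<^sub>R emb (r, y)"
    using t(3) by (simp add: vec_eq_iff forall_2 algebra_simps)
  moreover have "(1 - t) *\<^sub>R emb (l, y) + t *\<^sub>R emb (r, y) \<in> convex hull (emb ` S)"
    by (rule convexD_alt) (use assms t in \<open>auto simp: hull_inc\<close>)
  ultimately show ?thesis using assms(1) by (simp add: lattice_closed_def)
qed

lemma card_row:
  assumes "lattice_closed T" "finite T" "p \<in> T" "snd p = y"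
  obtains l r where "(l, y) \<in> T" "(r, y) \<in> T" "l \<le> r" "\<And>x. (x, y) \<in> T \<Longrightarrow> l \<le> x \<and> x \<le> r"
    "int (card {p \<in> T. snd p = y}) = r - l + 1"
proof -
  obtain l r where lr: "(l, y) \<in> T" "(r, y) \<in> T" "l \<le> r" "\<And>x. (x, y) \<in> T \<Longrightarrow> l \<le> x \<and> x \<le> r"
    using row_extremes[OF assms(2-4)] by blast
  have "{p \<in> T. snd p = y} = (\<lambda>x. (x, y)) ` {l..r}"
  proof
    show "{p \<in> T. snd p = y} \<subseteq> (\<lambda>x. (x, y)) ` {l..r}" using lr(4) by auto
    show "(\<lambda>x. (x, y)) ` {l..r} \<subseteq> {p \<in> T. snd p = y}"
      using lattice_closed_row[OF assms(1) lr(1,2)] by auto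
  qed
  then have "card {p \<in> T. snd p = y} = card {l..r}" by (simp add: card_image inj_on_def)
  then show thesis using lr that by simp
qed

lemma int_line_lvec: "int_line a b c = {v. lvec (of_int a) (of_int b) \<bullet> v = of_int c}"
  by (simp add: int_line_def inner_lvec)

lemma affine_hull_on_line:
  assumes "coprime a b" "X \<subseteq> int_line a b c" "u \<in> X" "v \<in> X" "u \<noteq> v"
  shows "affine hull X = int_line a b c" "aff_dim X = 1"
proof -
  have "a \<noteq> 0 \<or> b \<noteq> 0" using assms(1) by auto
  then have nz: "lvec (of_int a) (of_int b) \<noteq> 0" by (simp add: lvec_eq_0_iff)
  have d: "aff_dim (int_line a b c) = 1"
    unfolding int_line_lvec by (simp add: aff_dim_hyperplane[OF nz])
  have aff: "affine (int_line a b c)" unfolding int_line_lvec by (rule affine_hyperplane)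
  have "aff_dim {u, v} \<le> aff_dim X" by (rule aff_dim_subset) (use assms in auto)
  moreover have "aff_dim X \<le> aff_dim (int_line a b c)" by (rule aff_dim_subset) fact
  ultimately show 1: "aff_dim X = 1" using assms(5) d by (simp add: aff_dim_2)
  show "affine hull X = int_line a b c"
    by (rule affine_dim_equal) (use aff assms 1 d in \<open>auto simp: hull_minimal\<close>)
qed

lemma num_lattice_points_Int_line:
  assumes "lattice_closed S"
  shows "num_lattice_points (convex hull (emb ` S) \<inter> int_line a b c) = int (card {p \<in> S. a * fst p + b * snd p = c})"
proof -
  have "emb p \<in> convex hull (emb ` S) \<longleftrightarrow> p \<in> S" for p
    using assms hull_inc[of "emb p" "emb ` S"] unfolding lattice_closed_def by blast
  moreover have "emb p \<in> int_line a b c \<longleftrightarrow> a * fst p + b * snd p = c" for p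
    by (simp add: int_line_def flip: of_int_mult of_int_add)
  ultimately have "convex hull (emb ` S) \<inter> int_line a b c \<inter> lattice_points = emb ` {p \<in> S. a * fst p + b * snd p = c}"
    unfolding range_emb[symmetric] by auto
  then show ?thesis unfolding num_lattice_points_def
    by (simp add: card_image inj_on_subset[OF inj_emb])
qed

lemma supporting_edge:
  fixes a b c :: int
  assumes "coprime a b" "\<And>p. p \<in> S \<Longrightarrow> c \<le> a * fst p + b * snd p"
    "p \<in> S" "q \<in> S" "p \<noteq> q" "a * fst p + b * snd p = c" "a * fst q + b * snd q = c"
  shows "(convex hull (emb ` S) \<inter> int_line a b c) edge_of convex hull (emb ` S)"
    "affine hull (convex hull (emb ` S) \<inter> int_line a b c) = int_line a b c"
proof -
  let ?X = "convex hull (emb ` S) \<inter> int_line a b c"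
  have l: "lin (of_int a) (of_int b) r = of_int (a * fst r + b * snd r)" for r by (simp add: lin_def)
  have "\<forall>q\<in>S. of_int c \<le> lin (of_int a) (of_int b) q" unfolding l using assms(2) of_int_le_iff by blast
  then have "?X face_of convex hull (emb ` S)"
    unfolding lin_ge_hull_iff int_line_lvec
    by (intro face_of_Int_supporting_hyperplane_ge) auto
  moreover have m: "emb p \<in> ?X" "emb q \<in> ?X"
    using assms by (auto simp: hull_inc int_line_def simp flip: of_int_mult of_int_add)
  moreover have "emb p \<noteq> emb q" using assms(5) inj_emb by (auto dest: injD)
  ultimately show "?X edge_of convex hull (emb ` S)" "affine hull ?X = int_line a b c"
    using affine_hull_on_line[OF assms(1), of ?X c] by (auto simp: edge_of_def)
qed

text \<open>The two edges are the parts of the two hulls on rows 0 and 1, pulled back along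
  \<open>\<psi>\<close>; row y becomes the level y - f of the primitive form (a, b).\<close>

lemma situation5_if_shape5:
  assumes cl: "lattice_closed S" and fin: "finite S" and dim: "aff_dim (convex hull (emb ` S)) = 2"
    and u: "umap \<psi>" and sh: "shape5 (\<psi> ` S)"
  shows "\<exists>\<tau> \<tau>'. situation5 (convex hull (emb ` S)) \<tau> \<tau>'"
proof -
  obtain a' b' a b e f where 1: "\<bar>a' * b - b' * a\<bar> = 1"
    and psi: "\<psi> = (\<lambda>p. (a' * fst p + b' * snd p + e, a * fst p + b * snd p + f))"
    using u unfolding umap_def by blast
  have cop: "coprime a b"
  proof (rule coprimeI)
    fix x assume "x dvd a" "x dvd b"
    then have "x dvd a' * b - b' * a" by simp
    then show "is_unit x" using 1 by (metis dvd_abs_iff)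
  qed
  have sn: "snd (\<psi> p) = a * fst p + b * snd p + f" for p by (simp add: psi)
  have inj: "inj \<psi>" using umap_inverse[OF u] by (metis injI)
  note iu = inner_points_image[OF u, of S]
  obtain m M where up: "\<And>p. p \<in> S \<Longrightarrow> 0 \<le> snd (\<psi> p)" and mM: "(m, 0) \<in> \<psi> ` S" "(M, 0) \<in> \<psi> ` S"
    and card: "2 \<le> card {p \<in> inner_points (\<psi> ` S). snd p = 1}"
      "int (card {p \<in> inner_points (\<psi> ` S). snd p = 1}) \<le> M - m - 2"
    using sh unfolding shape5_def by auto
  have rows: "card {p \<in> X. a * fst p + b * snd p = y - f} = card {q \<in> \<psi> ` X. snd q = y}" for X y
  proof -
    have "{q \<in> \<psi> ` X. snd q = y} = \<psi> ` {p \<in> X. a * fst p + b * snd p = y - f}" by (auto simp: sn)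
    then show ?thesis by (simp add: card_image inj_on_subset[OF inj])
  qed
  have upI: "1 - f \<le> a * fst p + b * snd p" if "p \<in> inner_points S" for p
  proof -
    have "- f < a * fst p + b * snd p"
      by (rule inner_pointsD_int[OF that]) (use cop up in \<open>force simp: sn\<close>)+
    then show ?thesis by simp
  qed
  obtain p q where pq: "p \<in> S" "q \<in> S" "\<psi> p = (m, 0)" "\<psi> q = (M, 0)" using mM by (metis imageE)
  have pq': "p \<noteq> q" "a * fst p + b * snd p = 0 - f" "a * fst q + b * snd q = 0 - f"
    using pq(3,4) card sn[of p] sn[of q] by auto
  have up': "0 - f \<le> a * fst p + b * snd p" if "p \<in> S" for p using up[OF that] by (simp add: sn)
  note edge = supporting_edge[OF cop up' pq(1,2) pq']
  define R where "R = {p \<in> inner_points S. a * fst p + b * snd p = 1 - f}"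
  have cR: "card R = card {p \<in> inner_points (\<psi> ` S). snd p = 1}" unfolding R_def rows iu ..
  then have c2: "2 \<le> card R" using card by simp
  then obtain p1 where p1: "p1 \<in> R" by (metis card.empty equals0I not_numeral_le_zero)
  have "R \<noteq> {p1}" using c2 by auto
  then obtain q1 where q1: "q1 \<in> R" "p1 \<noteq> q1" using p1 by blast
  have "(convex hull (emb ` inner_points S) \<inter> int_line a b (1 - f)) edge_of convex hull (emb ` inner_points S)"
    "affine hull (convex hull (emb ` inner_points S) \<inter> int_line a b (1 - f)) = int_line a b (1 - f)"
    using supporting_edge[OF cop upI, where p = p1 and q = q1] p1 q1 by (auto simp: R_def)
  note edge' = this
  have clT: "lattice_closed (\<psi> ` S)" by (rule lattice_closed_image[OF u cl])
  \<comment> \<open>The row may extend beyond m and M, so its points are only bounded from below,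
    which is the direction required.\<close>
  have "(\<lambda>x. (x, 0)) ` {m..M} \<subseteq> {q \<in> \<psi> ` S. snd q = 0}"
    using lattice_closed_row[OF clT mM] by auto
  then have "card ((\<lambda>x. (x, 0::int)) ` {m..M}) \<le> card {q \<in> \<psi> ` S. snd q = 0}"
    by (rule card_mono[rotated]) (use fin in simp)
  moreover have "card ((\<lambda>x. (x, 0::int)) ` {m..M}) = nat (M - m + 1)" by (simp add: card_image inj_on_def)
  ultimately have c0: "M - m + 1 \<le> int (card {p \<in> S. a * fst p + b * snd p = 0 - f})" unfolding rows by linarith
  let ?t = "convex hull (emb ` S) \<inter> int_line a b (0 - f)"
  let ?t' = "convex hull (emb ` inner_points S) \<inter> int_line a b (1 - f)"
  have "lines_at_integral_distance (affine hull ?t) (affine hull ?t') 1"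
    unfolding lines_at_integral_distance_def
    by (rule exI[of _ a], rule exI[of _ b], rule exI[of _ "0 - f"], rule exI[of _ "1 - f"]) (use cop edge(2) edge'(2) in simp)
  moreover have "3 \<le> num_lattice_points ?t - num_lattice_points ?t'"
    unfolding num_lattice_points_Int_line[OF cl] num_lattice_points_Int_line[OF lattice_closed_inner_points]
      R_def[symmetric]
    using c0 card(2) cR by linarith
  ultimately have "situation5 (convex hull (emb ` S)) ?t ?t'"
    unfolding situation5_def interior_polygon_hull[OF dim] using edge(1) edge'(1) by blast
  then show ?thesis by blast
qed

text \<open>If D had points strictly on both sides of the line, the segment joining them would cross
  the face at a relative interior point of the segment, and the face would have to contain the
  endpoint v.\<close>

lemma edge_supporting_side:
  assumes D: "convex D" and face: "(D \<inter> int_line a b c) face_of D" and v: "v \<in> D" "w \<in> D"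
    and lt: "of_int a * v $ 1 + of_int b * v $ 2 < of_int c"
  shows "of_int a * w $ 1 + of_int b * w $ 2 \<le> of_int c"
proof (rule ccontr)
  assume gt: "\<not> of_int a * w $ 1 + of_int b * w $ 2 \<le> of_int c"
  define fv fw where "fv = of_int c - (of_int a * v $ 1 + of_int b * v $ 2)"
    and "fw = of_int a * w $ 1 + of_int b * w $ 2 - of_int c"
  have pos: "0 < fv" "0 < fw" using lt gt by (auto simp: fv_def fw_def)
  \<comment> \<open>With this weight the two signed offsets cancel, which puts z on the
    line.\<close>
  define t where "t = fv / (fv + fw)"
  have t: "0 < t" "t < 1" "(1 - t) * fv = t * fw" using pos by (auto simp: t_def field_simps)
  define z where "z = (1 - t) *\<^sub>R v + t *\<^sub>R w"
  have "v \<noteq> w" using pos by (auto simp: fv_def fw_def)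
  then have seg: "z \<in> open_segment v w" unfolding z_def in_segment using t by auto
  have "z \<in> D" unfolding z_def using D v t by (intro convexD_alt) auto
  have "of_int a * z $ 1 + of_int b * z $ 2 - of_int c = t * fw - (1 - t) * fv"
    by (simp add: z_def fv_def fw_def algebra_simps)
  then have "z \<in> int_line a b c" using t(3) by (simp add: int_line_def)
  then have "v \<in> D \<inter> int_line a b c"
    using face v seg \<open>z \<in> D\<close> unfolding face_of_def by blast
  then show False using lt by (simp add: int_line_def)
qed

lemma inner_points_subset:
  assumes "lattice_closed S" "aff_dim (convex hull (emb ` S)) = 2"
  shows "inner_points S \<subseteq> S"
proof
  fix p assume "p \<in> inner_points S"
  then have "emb p \<in> convex hull (emb ` S)"
    using interior_lattice_points[OF assms(2)] interior_subset by blast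
  then show "p \<in> S" using assms(1) unfolding lattice_closed_def by blast
qed

text \<open>Bezout completes the primitive form (a, b) to a unimodular matrix with that second
  row.\<close>

lemma ex_umap_snd:
  assumes "coprime a (b::int)"
  obtains \<psi> where "umap \<psi>" "\<And>p. snd (\<psi> p) = a * fst p + b * snd p - c"
proof -
  obtain s t where "s * a + t * b = 1" using bezout_int[of a b] assms by auto
  then have "\<bar>t * b - (- s) * a\<bar> = 1" by (simp add: algebra_simps)
  then have "umap (\<lambda>p. (t * fst p + (- s) * snd p + 0, a * fst p + b * snd p + (- c)))" by (rule umapI)
  then show thesis by (rule that) simp
qed

lemma situation5_values:
  assumes cl: "lattice_closed S" and fin: "finite S" and dim: "aff_dim (convex hull (emb ` S)) = 2"
    and s5: "situation5 (convex hull (emb ` S)) \<tau> \<tau>'"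
  shows "ls_square (interior_polygon (convex hull (emb ` S))) = num_lattice_points \<tau>' - 1"
    "ls_square (convex hull (emb ` S)) = num_lattice_points \<tau> - 1"
proof -
  let ?D = "convex hull (emb ` S)" and ?I = "convex hull (emb ` inner_points S)"
  have int: "interior_polygon ?D = ?I" by (rule interior_polygon_hull[OF dim])
  obtain a0 b0 c0 c0' where cop0: "coprime a0 b0" and aff0: "affine hull \<tau> = int_line a0 b0 c0" "affine hull \<tau>' = int_line a0 b0 c0'"
    and dist0: "1 = \<bar>c0 - c0'\<bar>"
    using s5 unfolding situation5_def lines_at_integral_distance_def by blast
  have faces: "\<tau> face_of ?D" "\<tau>' face_of ?I" "aff_dim \<tau>' = 1" and num: "3 \<le> num_lattice_points \<tau> - num_lattice_points \<tau>'"
    using s5 unfolding situation5_def int edge_of_def by auto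
  have t0: "\<tau> = ?D \<inter> int_line a0 b0 c0" "\<tau>' = ?I \<inter> int_line a0 b0 c0'"
    using face_of_imp_eq_affine_Int[OF convex_convex_hull faces(1)] face_of_imp_eq_affine_Int[OF convex_convex_hull faces(2)] aff0 by auto
  \<comment> \<open>The given normal of the edge line may point outward; negating all four constants
    then puts S on the side >= c.\<close>
  have "\<exists>a b c c'. coprime a b \<and> \<tau> = ?D \<inter> int_line a b c \<and> \<tau>' = ?I \<inter> int_line a b c' \<and> \<bar>c - c'\<bar> = 1 \<and>
      (\<forall>p\<in>S. c \<le> a * fst p + b * snd p)"
  proof (cases "\<forall>p\<in>S. c0 \<le> a0 * fst p + b0 * snd p")
    case True
    then show ?thesis using cop0 t0 dist0 by metis
  next
    case False
    then obtain p where p: "p \<in> S" "a0 * fst p + b0 * snd p < c0" by (auto simp: not_le)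
    have "a0 * fst q + b0 * snd q \<le> c0" if "q \<in> S" for q
    proof -
      have "of_int a0 * emb q $ 1 + of_int b0 * emb q $ 2 \<le> of_int c0"
        by (rule edge_supporting_side[of ?D _ _ _ "emb p"])
          (use faces(1) t0(1) p that in \<open>auto simp: hull_inc simp flip: of_int_mult of_int_add\<close>)
      then show ?thesis by (simp flip: of_int_mult of_int_add)
    qed
    then have "\<forall>p\<in>S. - c0 \<le> (- a0) * fst p + (- b0) * snd p" by fastforce
    moreover have "int_line (- a0) (- b0) (- k) = int_line a0 b0 k" for k
      by (auto simp: int_line_def)
    moreover have "coprime (- a0) (- b0)" "\<bar>- c0 - (- c0')\<bar> = 1" using cop0 dist0 by auto
    ultimately show ?thesis using t0 by metis
  qed
  then obtain a b c c' where cop: "coprime a b" and t: "\<tau> = ?D \<inter> int_line a b c" "\<tau>' = ?I \<inter> int_line a b c'"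
    and dist: "\<bar>c - c'\<bar> = 1" and up: "\<And>p. p \<in> S \<Longrightarrow> c \<le> a * fst p + b * snd p"
    by blast
  have finI: "finite (inner_points S)" using inner_points_subset[OF cl dim] fin finite_subset by blast
  have upI: "c < a * fst p + b * snd p" if "p \<in> inner_points S" for p
    by (rule inner_pointsD_int[OF that _ up]) (use cop in auto)
  \<comment> \<open>Distance 1 alone allows c' = c - 1. As a face of a hull, \<open>\<tau>'\<close>
    contains a generator, that is, an interior lattice point, and this lies strictly above level
    c.\<close>
  have "compact (emb ` inner_points S)" using finI by (simp add: finite_imp_compact)
  then obtain X where X: "X \<subseteq> emb ` inner_points S" "\<tau>' = convex hull X"
    using faces(2) face_of_convex_hull_subset by blast
  have "X \<noteq> {}" using X(2) faces(3) by auto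
  then obtain p where p: "p \<in> inner_points S" "emb p \<in> X" using X(1) by blast
  then have "emb p \<in> int_line a b c'" using X(2) t(2) hull_inc[of "emb p" X] by blast
  then have pc: "a * fst p + b * snd p = c'" by (simp add: int_line_def flip: of_int_mult of_int_add)
  then have c': "c' = c + 1" using upI[OF p(1)] dist by linarith
  obtain \<psi> where u: "umap \<psi>" and sn: "\<And>p. snd (\<psi> p) = a * fst p + b * snd p - c"
    using ex_umap_snd[OF cop] by blast
  note iu = inner_points_image[OF u, of S]
  have inj: "inj \<psi>" using umap_inverse[OF u] by (metis injI)
  have rows: "card {p \<in> X. a * fst p + b * snd p = y} = card {q \<in> \<psi> ` X. snd q = y - c}" for X y
  proof -
    have "{q \<in> \<psi> ` X. snd q = y - c} = \<psi> ` {p \<in> X. a * fst p + b * snd p = y}" by (auto simp: sn)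
    then show ?thesis by (simp add: card_image inj_on_subset[OF inj])
  qed
  have n: "num_lattice_points \<tau> = int (card {q \<in> \<psi> ` S. snd q = 0})"
    "num_lattice_points \<tau>' = int (card {q \<in> inner_points (\<psi> ` S). snd q = 1})"
    unfolding t num_lattice_points_Int_line[OF cl] num_lattice_points_Int_line[OF lattice_closed_inner_points] rows iu c'
    by simp_all
  have clT: "lattice_closed (\<psi> ` S)" "lattice_closed (inner_points (\<psi> ` S))"
    using lattice_closed_image[OF u cl] lattice_closed_inner_points by auto
  have finT: "finite (\<psi> ` S)" "finite (inner_points (\<psi> ` S))" using fin finI by (simp_all add: iu)
  have "card {q \<in> \<psi> ` S. snd q = 0} \<noteq> 0" using num n by linarith
  then have "{q \<in> \<psi> ` S. snd q = 0} \<noteq> {}" by (metis card.empty)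
  then obtain p0 where p0: "p0 \<in> \<psi> ` S" "snd p0 = 0" by blast
  have p1: "\<psi> p \<in> inner_points (\<psi> ` S)" "snd (\<psi> p) = 1" using p(1) pc c' by (auto simp: iu sn)
  obtain l r where lr: "(l, 0) \<in> \<psi> ` S" "(r, 0) \<in> \<psi> ` S" "l \<le> r" "\<And>x. (x, 0) \<in> \<psi> ` S \<Longrightarrow> l \<le> x \<and> x \<le> r"
    "int (card {p \<in> \<psi> ` S. snd p = 0}) = r - l + 1"
    using card_row[OF clT(1) finT(1) p0] by blast
  obtain i j where ij: "(i, 1) \<in> inner_points (\<psi> ` S)" "(j, 1) \<in> inner_points (\<psi> ` S)" "i \<le> j"
    "\<And>x. (x, 1) \<in> inner_points (\<psi> ` S) \<Longrightarrow> i \<le> x \<and> x \<le> j"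
    "int (card {p \<in> inner_points (\<psi> ` S). snd p = 1}) = j - i + 1"
    using card_row[OF clT(2) finT(2) p1] by blast
  have upT: "0 \<le> snd q" if "q \<in> \<psi> ` S" for q using that up by (auto simp: sn)
  have "j - i + 3 \<le> r - l" using num n lr(5) ij(5) by linarith
  note lattice_size = long_edge_lattice_sizes[OF lr(1,2) upT lr(4) ij(1-4) this]
  show "ls_square (interior_polygon ?D) = num_lattice_points \<tau>' - 1"
    unfolding int ls_square_hull n using lattice_size(2) ij(5) lattice_size_image[OF u, of "inner_points S"] by (simp add: iu)
  show "ls_square ?D = num_lattice_points \<tau> - 1"
    unfolding ls_square_hull n using lattice_size(1) lr(5) lattice_size_image[OF u, of S] by simp
qed

subsection \<open>The theorem\<close>

text \<open>The generators are traded for all lattice points of P, finitely many by boundedness, so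
  that \<open>lattice_closed\<close> holds from the outset.\<close>

lemma lattice_polygonE:
  assumes "lattice_polygon P"
  obtains S where "finite S" "lattice_closed S" "P = convex hull (emb ` S)"
proof -
  obtain S0 where S0: "finite S0" "S0 \<subseteq> lattice_points" "P = convex hull S0"
    using assms unfolding lattice_polygon_def by blast
  define S where "S = {p. emb p \<in> P}"
  have "bounded P" using S0 by (simp add: finite_imp_bounded bounded_convex_hull)
  then obtain B where B: "\<And>v. v \<in> P \<Longrightarrow> norm v \<le> B" unfolding bounded_iff by blast
  have "S \<subseteq> {- \<lceil>B\<rceil>..\<lceil>B\<rceil>} \<times> {- \<lceil>B\<rceil>..\<lceil>B\<rceil>}"
  proof
    fix p assume "p \<in> S"
    then have "norm (emb p) \<le> B" using B by (simp add: S_def)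
    then have "\<bar>emb p $ 1\<bar> \<le> B" "\<bar>emb p $ 2\<bar> \<le> B" using component_le_norm_cart order_trans by blast+
    then have "\<bar>fst p\<bar> \<le> \<lceil>B\<rceil>" "\<bar>snd p\<bar> \<le> \<lceil>B\<rceil>" by (simp; linarith)+
    then show "p \<in> {- \<lceil>B\<rceil>..\<lceil>B\<rceil>} \<times> {- \<lceil>B\<rceil>..\<lceil>B\<rceil>}" by (cases p) (auto simp: abs_le_iff)
  qed
  then have fin: "finite S" by (rule finite_subset) simp
  have P: "P = convex hull (emb ` S)"
  proof
    have "S0 \<subseteq> emb ` S"
    proof
      fix v assume v: "v \<in> S0"
      then obtain p where "v = emb p" using S0(2) lattice_pointsE by blast
      then show "v \<in> emb ` S" using v S0(3) hull_inc[of v S0] by (auto simp: S_def)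
    qed
    then show "P \<subseteq> convex hull (emb ` S)" unfolding S0(3) by (rule hull_mono)
    show "convex hull (emb ` S) \<subseteq> P"
      by (rule hull_minimal) (auto simp: S_def S0(3))
  qed
  have "lattice_closed S" unfolding lattice_closed_def P[symmetric] by (auto simp: S_def)
  then show thesis using that fin P by blast
qed

lemma not_collinear_pts:
  assumes "aff_dim (convex hull (emb ` S)) = 2"
  shows "\<not> collinear_pts S"
proof
  assume "collinear_pts S"
  then obtain a b c where ab: "a \<noteq> 0 \<or> b \<noteq> 0" and l: "\<And>p. p \<in> S \<Longrightarrow> a * fst p + b * snd p = c"
    unfolding collinear_pts_def by blast
  have nz: "lvec (of_int a) (of_int b) \<noteq> 0" using ab by (simp add: lvec_eq_0_iff)
  have "convex hull (emb ` S) \<subseteq> int_line a b c"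
    unfolding int_line_lvec
  proof (rule hull_minimal)
    show "convex {v. lvec (of_int a) (of_int b) \<bullet> v = of_int c}" by (rule convex_hyperplane)
    show "emb ` S \<subseteq> {v. lvec (of_int a) (of_int b) \<bullet> v = of_int c}"
      using l by (auto simp: inner_lvec simp flip: of_int_mult of_int_add)
  qed
  then have "aff_dim (convex hull (emb ` S)) \<le> aff_dim (int_line a b c)" by (rule aff_dim_subset)
  also have "\<dots> = 1" unfolding int_line_lvec by (simp add: aff_dim_hyperplane[OF nz])
  finally show False using assms by simp
qed

lemma not_fits_0:
  assumes "\<not> collinear_pts S"
  shows "\<not> fits_square 0 S"
proof
  assume "fits_square 0 S"
  then obtain \<psi> where u: "umap \<psi>" and b: "\<And>p. p \<in> S \<Longrightarrow> 0 \<le> fst (\<psi> p) \<and> fst (\<psi> p) \<le> 0 \<and> 0 \<le> snd (\<psi> p) \<and> snd (\<psi> p) \<le> 0"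
    using fits_squareE by metis
  have "\<forall>p\<in>\<psi> ` S. 0 * fst p + 1 * snd p = 0" using b by force
  then have "collinear_pts (\<psi> ` S)" unfolding collinear_pts_def by (metis zero_neq_one)
  then show False using collinear_pts_image[OF u] assms by blast
qed

lemma generic_lattice_size:
  assumes fin: "finite S" and cl: "lattice_closed S" and P: "P = convex hull (emb ` S)" and dim: "aff_dim P = 2"
    and no: "\<not> (\<exists>a b. situation1 P a b)" "\<not> situation2 P" "\<not> situation3 P" "\<not> situation4 P"
      "\<not> (\<exists>\<tau> \<tau>'. situation5 P \<tau> \<tau>')"
  shows "lattice_size S = lattice_size (inner_points S) + 2"
proof -
  have dim': "aff_dim (convex hull (emb ` S)) = 2" using dim P by simp
  have nc: "\<not> collinear_pts S" by (rule not_collinear_pts[OF dim'])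
  have ne: "S \<noteq> {}" using dim' by auto
  show ?thesis
  proof (cases "inner_points S = {}")
    case True
    have "strip S" using hollow_cases[OF fin nc True] situation2_if_shape2 no(2) P by blast
    then obtain \<psi> a b where u: "umap \<psi>" and sh: "shape1 a b (\<psi> ` S)"
      using strip_normal_form[OF fin nc] by blast
    \<comment> \<open>A strip with a >= 2 is situation 1. The remaining ones fit into the unit
      square, and the generic formula reads 1 = -1 + 2.\<close>
    have "a < 2" using situation1_if_shape1[OF u sh] no(1) P by force
    then have "0 \<le> fst p \<and> fst p \<le> 1 \<and> 0 \<le> snd p \<and> snd p \<le> 1" if "p \<in> \<psi> ` S" for p
      using sh that unfolding shape1_def by force
    then have "fits_square 1 (\<psi> ` S)" by (rule fits_squareI[OF umap_id])
    then have "fits_square 1 S" using fits_square_image[OF u] by blast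
    then have "lattice_size S = 1"
    proof (rule lattice_size_eqI[OF ne, rotated])
      show "\<not> fits_square d S" if "0 \<le> d" "d < 1" for d
      proof -
        have "d = 0" using that by simp
        then show ?thesis using not_fits_0[OF nc] by simp
      qed
    qed simp
    then show ?thesis using True by (simp add: lattice_size_def)
  next
    case False
    have finI: "finite (inner_points S)"
      using inner_points_subset[OF cl dim'] fin finite_subset by blast
    note d = fits_square_lattice_size[OF finI False] and e = fits_square_lattice_size[OF fin ne]
    have "fits_square (lattice_size (inner_points S) + 2) S"
    proof (rule ccontr)
      assume "\<not> ?thesis"
      then have "exceptional S" by (rule exceptional_if_not_fits[OF fin False finI d])
      then obtain \<psi> where "umap \<psi>" "shape3 (\<psi> ` S) \<or> shape4 (\<psi> ` S) \<or> shape5 (\<psi> ` S)"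
        unfolding exceptional_def by blast
      then show False
        using situation3_if_shape3 situation4_if_shape4 situation5_if_shape5[OF cl fin dim'] no(3-5)
        unfolding P by blast
    qed
    then have "lattice_size S \<le> lattice_size (inner_points S) + 2" using d(1) by (intro lattice_size_le) auto
    moreover have "lattice_size (inner_points S) \<le> lattice_size S - 2"
      using fits_square_inner_points[OF e(2) False] by (intro lattice_size_le) auto
    ultimately show ?thesis by linarith
  qed
qed

theorem theorem4:
  fixes \<Delta> :: "(real^2) set"
  assumes "lattice_polygon \<Delta>" and "aff_dim \<Delta> = 2"
  shows "(\<not> (\<exists>a b. situation1 \<Delta> a b) \<and> \<not> situation2 \<Delta> \<and> \<not> situation3 \<Delta> \<and> \<not> situation4 \<Delta> \<and>
            \<not> (\<exists>\<tau> \<tau>'. situation5 \<Delta> \<tau> \<tau>') \<longrightarrow>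
          ls_square \<Delta> = ls_square (interior_polygon \<Delta>) + 2) \<and>
         (\<forall>a b. situation1 \<Delta> a b \<longrightarrow>
            ls_square (interior_polygon \<Delta>) = -1 \<and> ls_square \<Delta> = a) \<and>
         (situation2 \<Delta> \<longrightarrow> ls_square (interior_polygon \<Delta>) = -1 \<and> ls_square \<Delta> = 2) \<and>
         (situation3 \<Delta> \<longrightarrow> ls_square (interior_polygon \<Delta>) = 0 \<and> ls_square \<Delta> = 3) \<and>
         (situation4 \<Delta> \<longrightarrow> ls_square (interior_polygon \<Delta>) = 0 \<and> ls_square \<Delta> = 4) \<and>
         (\<forall>\<tau> \<tau>'. situation5 \<Delta> \<tau> \<tau>' \<longrightarrow>
            ls_square (interior_polygon \<Delta>) = num_lattice_points \<tau>' - 1 \<and>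
            ls_square \<Delta> = num_lattice_points \<tau> - 1)"
proof -
  obtain S where S: "finite S" "lattice_closed S" "\<Delta> = convex hull (emb ` S)"
    using lattice_polygonE[OF assms(1)] by blast
  have dim: "aff_dim (convex hull (emb ` S)) = 2" using assms(2) S(3) by simp
  have "ls_square \<Delta> = ls_square (interior_polygon \<Delta>) + 2"
    if "\<not> (\<exists>a b. situation1 \<Delta> a b) \<and> \<not> situation2 \<Delta> \<and> \<not> situation3 \<Delta> \<and> \<not> situation4 \<Delta> \<and>
      \<not> (\<exists>\<tau> \<tau>'. situation5 \<Delta> \<tau> \<tau>')"
    using generic_lattice_size[OF S assms(2)] that
    by (simp add: S(3) interior_polygon_hull[OF dim] ls_square_hull)
  then show ?thesis
    using situation_values[OF S(3) assms(2)] situation5_values[OF S(2,1) dim, folded S(3)] by blast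
qed

end
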